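(* Let $q:\mathbb{R}\to\mathbb{C}$, $q_0>0$, and let $\theta_\pm\in[0,2\pi)$ with $\theta_++\theta_-\equiv 0 \pmod{2\pi}$. Put $q_\pm=q_0e^{i\theta_\pm}$ and assume $q(x)\to q_\pm$ as $x\to\pm\infty$, with $q-q_+\in L^1([0,\infty))$ and $q-q_-\in L^1((-\infty,0])$ (i.e. the entries of $Q-Q_\pm$ are integrable at $\pm\infty$). Then for each $x\in\mathbb{R}$, the eigenfunctions $M(x,k)$ and $N(x,k)$ exist, are continuous for $k\in\overline{\mathbb{C}}_1\setminus\{\pm q_0\}$ and analytic for $k\in\mathbb{C}_1$, and $\overline{M}(x,k)$, $\overline{N}(x,k)$ exist, are continuous for $k\in\overline{\mathbb{C}}_2\setminus\{\pm q_0\}$ and analytic for $k\in\mathbb{C}_2$. If in addition $(1+|x|)^2|q(x)-q_+|$ is integrable on $[0,\infty)$ and $(1+|x|)^2|q(x)-q_-|$ is integrable on $(-\infty,0]$, then for each $x$, $M(x,\cdot)$ and $N(x,\cdot)$ are continuous on all of $\overline{\mathbb{C}}_1$ (including $k=\pm q_0$) and analytic in $\mathbb{C}_1$, and $\overline{M}(x,\cdot),\overline{N}(x,\cdot)$ are continuous on all of $\overline{\mathbb{C}}_2$ and analytic in $\mathbb{C}_2$.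
   Context: Scattering problem (time frozen): $v_x=(ikJ+Q)v$ with $J=\mathrm{diag}(-1,1)$, $Q(x)=\begin{pmatrix}0&q(x)\\ q(-x)&0\end{pmatrix}$, and $Q_\pm=\begin{pmatrix}0&q_\pm\\ q_\mp&0\end{pmatrix}$. Riemann surface of $\lambda=\sqrt{k^2-q_0^2}$: write $k-q_0=r_1e^{i\theta_1}$, $0\le\theta_1<2\pi$, $k+q_0=r_2e^{i\theta_2}$, $-\pi\le\theta_2<\pi$, and $\lambda_1(k)=(r_1r_2)^{1/2}e^{i(\theta_1+\theta_2)/2}$. The sheet $\mathbb{C}_1$ is the complex $k$-plane cut along $(-\infty,-q_0]\cup[q_0,\infty)$ with $\lambda=\lambda_1$ (so $\operatorname{Im}\lambda>0$ off the cut), the sheet $\mathbb{C}_2$ is the same cut plane with $\lambda=-\lambda_1$ ($\operatorname{Im}\lambda<0$ off the cut); $\overline{\mathbb{C}}_j$ includes the two edges of the cut. The eigenfunctions are the solutions of the integral equations $M(x,k)=(\lambda+k,\,iq_+)^T+\int_{\mathbb{R}}G_-(x-x',k)(Q-Q_-)(x')M(x',k)\,dx'$, $\overline{M}(x,k)=(-iq_-,\,\lambda+k)^T+\int_{\mathbb{R}}\overline{G}_-(x-x',k)(Q-Q_-)(x')\overline{M}(x',k)\,dx'$, $N(x,k)=(-iq_+,\,\lambda+k)^T+\int_{\mathbb{R}}G_+(x-x',k)(Q-Q_+)(x')N(x',k)\,dx'$, $\overline{N}(x,k)=(\lambda+k,\,iq_-)^T+\int_{\mathbb{R}}\overline{G}_+(x-x',k)(Q-Q_+)(x')\overline{N}(x',k)\,dx'$,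 with $H$ the Heaviside function and $G_-(x,k)=\frac{H(x)}{2\lambda}[(1+e^{2i\lambda x})\lambda I-i(e^{2i\lambda x}-1)(ikJ+Q_-)]$, $\overline{G}_-(x,k)=\frac{H(x)}{2\lambda}[(1+e^{-2i\lambda x})\lambda I+i(e^{-2i\lambda x}-1)(ikJ+Q_-)]$, $G_+(x,k)=-\frac{H(-x)}{2\lambda}[(1+e^{-2i\lambda x})\lambda I+i(e^{-2i\lambda x}-1)(ikJ+Q_+)]$, $\overline{G}_+(x,k)=-\frac{H(-x)}{2\lambda}[(1+e^{2i\lambda x})\lambda I-i(e^{2i\lambda x}-1)(ikJ+Q_+)]$. Equivalently $M=e^{i\lambda x}\phi$, $\overline M=e^{-i\lambda x}\overline\phi$, $N=e^{-i\lambda x}\psi$, $\overline N=e^{i\lambda x}\overline\psi$ where $\phi,\overline\phi,\psi,\overline\psi$ are the Jost solutions of the scattering problem with $\phi\sim(\lambda+k,iq_+)^Te^{-i\lambda x}$, $\overline\phi\sim(-iq_-,\lambda+k)^Te^{i\lambda x}$ as $x\to-\infty$ and $\psi\sim(-iq_+,\lambda+k)^Te^{i\lambda x}$, $\overline\psi\sim(\lambda+k,iq_-)^Te^{-i\lambda x}$ as $x\to+\infty$. *)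

theory Defs
  imports "HOL-Analysis.Analysis"
begin

type_synonym cvec = "complex \<times> complex"
type_synonym cmat = "complex \<times> complex \<times> complex \<times> complex"
  \<comment> \<open>(a,b,c,d) stands for the matrix [[a,b],[c,d]]\<close>

definition mId :: cmat where "mId = (1, 0, 0, 1)"

definition mscale :: "complex \<Rightarrow> cmat \<Rightarrow> cmat" where
  "mscale s M = (case M of (a, b, c, d) \<Rightarrow> (s * a, s * b, s * c, s * d))"

definition madd :: "cmat \<Rightarrow> cmat \<Rightarrow> cmat" where
  "madd M N = (case M of (a, b, c, d) \<Rightarrow> case N of (a', b', c', d') \<Rightarrow>
      (a + a', b + b', c + c', d + d'))"

definition msub :: "cmat \<Rightarrow> cmat \<Rightarrow> cmat" where
  "msub M N = madd M (mscale (-1) N)"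

definition mmul :: "cmat \<Rightarrow> cmat \<Rightarrow> cmat" where
  "mmul M N = (case M of (a, b, c, d) \<Rightarrow> case N of (a', b', c', d') \<Rightarrow>
      (a * a' + b * c', a * b' + b * d', c * a' + d * c', c * b' + d * d'))"

definition mvec :: "cmat \<Rightarrow> cvec \<Rightarrow> cvec" where
  "mvec M v = (case M of (a, b, c, d) \<Rightarrow> case v of (y, z) \<Rightarrow> (a * y + b * z, c * y + d * z))"

definition Jmat :: cmat where "Jmat = (-1, 0, 0, 1)"

definition Qmat :: "(real \<Rightarrow> complex) \<Rightarrow> real \<Rightarrow> cmat" where
  "Qmat q x = (0, q x, q (- x), 0)"

text \<open>Q_+ = [[0,q_+],[q_-,0]] is QinfM qp qm; Q_- = [[0,q_-],[q_+,0]] is QinfM qm qp\<close>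
definition QinfM :: "complex \<Rightarrow> complex \<Rightarrow> cmat" where
  "QinfM a b = (0, a, b, 0)"

definition ikJplus :: "complex \<Rightarrow> cmat \<Rightarrow> cmat" where
  "ikJplus k B = madd (mscale (\<i> * k) Jmat) B"

definition heaviside :: "real \<Rightarrow> complex" where
  "heaviside x = (if x \<ge> 0 then 1 else 0)"

definition arg_0_2pi :: "complex \<Rightarrow> real" where
  "arg_0_2pi z = (if Arg z < 0 then Arg z + 2 * pi else Arg z)"

definition arg_mpi_pi :: "complex \<Rightarrow> real" where
  "arg_mpi_pi z = (if Arg z = pi then - pi else Arg z)"

definition lambda1 :: "real \<Rightarrow> complex \<Rightarrow> complex" where
  "lambda1 q0 k =
     complex_of_real (sqrt (cmod (k - of_real q0) * cmod (k + of_real q0))) *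
     exp (\<i> * complex_of_real ((arg_0_2pi (k - of_real q0) + arg_mpi_pi (k + of_real q0)) / 2))"

definition branch_cut :: "real \<Rightarrow> complex set" where
  "branch_cut q0 = {k. Im k = 0 \<and> \<bar>Re k\<bar> \<ge> q0}"

text \<open>Both sheets C_1, C_2 have the cut plane as underlying k-domain;
  on C_1, lambda = lambda1, on C_2, lambda = - lambda1.\<close>
definition sheet_domain :: "real \<Rightarrow> complex set" where
  "sheet_domain q0 = UNIV - branch_cut q0"

text \<open>Points of the closed sheets (including both edges of the cut) are
  represented as pairs (k, lambda); the closed sheet is the closure of the
  graph of lambda over the cut plane. The two edges of the cut are
  distinguished by the value of lambda.\<close>
definition closed_sheet1 :: "real \<Rightarrow> (complex \<times> complex) set" where
  "closed_sheet1 q0 = closure ((\<lambda>k. (k, lambda1 q0 k)) ` sheet_domain q0)"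

definition closed_sheet2 :: "real \<Rightarrow> (complex \<times> complex) set" where
  "closed_sheet2 q0 = closure ((\<lambda>k. (k, - lambda1 q0 k)) ` sheet_domain q0)"

definition branch_points :: "real \<Rightarrow> (complex \<times> complex) set" where
  "branch_points q0 = {p. fst p = of_real q0 \<or> fst p = - of_real q0}"

text \<open>At lambda = 0 (branch points) the kernels are defined by their
  (removable) limit values.\<close>

definition Gm :: "complex \<Rightarrow> complex \<Rightarrow> complex \<Rightarrow> real \<Rightarrow> complex \<Rightarrow> cmat" where
  "Gm qp qm lam x k =
     (if lam = 0 then mscale (heaviside x) (madd mId (mscale (of_real x) (ikJplus k (QinfM qm qp))))
      else mscale (heaviside x / (2 * lam))
        (msub (mscale ((1 + exp (2 * \<i> * lam * of_real x)) * lam) mId)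
              (mscale (\<i> * (exp (2 * \<i> * lam * of_real x) - 1)) (ikJplus k (QinfM qm qp)))))"

definition Gmbar :: "complex \<Rightarrow> complex \<Rightarrow> complex \<Rightarrow> real \<Rightarrow> complex \<Rightarrow> cmat" where
  "Gmbar qp qm lam x k =
     (if lam = 0 then mscale (heaviside x) (madd mId (mscale (of_real x) (ikJplus k (QinfM qm qp))))
      else mscale (heaviside x / (2 * lam))
        (madd (mscale ((1 + exp (- 2 * \<i> * lam * of_real x)) * lam) mId)
              (mscale (\<i> * (exp (- 2 * \<i> * lam * of_real x) - 1)) (ikJplus k (QinfM qm qp)))))"

definition Gp :: "complex \<Rightarrow> complex \<Rightarrow> complex \<Rightarrow> real \<Rightarrow> complex \<Rightarrow> cmat" where
  "Gp qp qm lam x k =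
     (if lam = 0 then mscale (- heaviside (- x)) (madd mId (mscale (of_real x) (ikJplus k (QinfM qp qm))))
      else mscale (- heaviside (- x) / (2 * lam))
        (madd (mscale ((1 + exp (- 2 * \<i> * lam * of_real x)) * lam) mId)
              (mscale (\<i> * (exp (- 2 * \<i> * lam * of_real x) - 1)) (ikJplus k (QinfM qp qm)))))"

definition Gpbar :: "complex \<Rightarrow> complex \<Rightarrow> complex \<Rightarrow> real \<Rightarrow> complex \<Rightarrow> cmat" where
  "Gpbar qp qm lam x k =
     (if lam = 0 then mscale (- heaviside (- x)) (madd mId (mscale (of_real x) (ikJplus k (QinfM qp qm))))
      else mscale (- heaviside (- x) / (2 * lam))
        (msub (mscale ((1 + exp (2 * \<i> * lam * of_real x)) * lam) mId)
              (mscale (\<i> * (exp (2 * \<i> * lam * of_real x) - 1)) (ikJplus k (QinfM qp qm)))))"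

definition solves_inteq ::
  "(complex \<Rightarrow> real \<Rightarrow> complex \<Rightarrow> cmat) \<Rightarrow> (real \<Rightarrow> cmat) \<Rightarrow> (complex \<times> complex \<Rightarrow> cvec)
    \<Rightarrow> (complex \<times> complex) set \<Rightarrow> (real \<Rightarrow> complex \<times> complex \<Rightarrow> cvec) \<Rightarrow> bool" where
  "solves_inteq G QmQ F0 S F \<longleftrightarrow>
     (\<forall>p\<in>S. \<forall>x::real.
        integrable lborel (\<lambda>x'. mvec (mmul (G (snd p) (x - x') (fst p)) (QmQ x')) (F x' p)) \<and>
        F x p = F0 p + (\<integral>x'. mvec (mmul (G (snd p) (x - x') (fst p)) (QmQ x')) (F x' p) \<partial>lborel))"

definition M_eq where
  "M_eq q qp qm S M \<longleftrightarrow> solves_inteq (Gm qp qm) (\<lambda>x. msub (Qmat q x) (QinfM qm qp))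
      (\<lambda>p. (snd p + fst p, \<i> * qp)) S M"

definition Mbar_eq where
  "Mbar_eq q qp qm S M \<longleftrightarrow> solves_inteq (Gmbar qp qm) (\<lambda>x. msub (Qmat q x) (QinfM qm qp))
      (\<lambda>p. (- \<i> * qm, snd p + fst p)) S M"

definition N_eq where
  "N_eq q qp qm S N \<longleftrightarrow> solves_inteq (Gp qp qm) (\<lambda>x. msub (Qmat q x) (QinfM qp qm))
      (\<lambda>p. (- \<i> * qp, snd p + fst p)) S N"

definition Nbar_eq where
  "Nbar_eq q qp qm S N \<longleftrightarrow> solves_inteq (Gpbar qp qm) (\<lambda>x. msub (Qmat q x) (QinfM qp qm))
      (\<lambda>p. (snd p + fst p, \<i> * qm)) S N"

definition regular_on ::
  "real \<Rightarrow> (complex \<Rightarrow> complex) \<Rightarrow> (complex \<times> complex) set \<Rightarrow> (real \<Rightarrow> complex \<times> complex \<Rightarrow> cvec) \<Rightarrow> bool" where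
  "regular_on q0 lam S F \<longleftrightarrow>
     (\<forall>x. continuous_on S (F x) \<and>
          (\<lambda>k. fst (F x (k, lam k))) holomorphic_on sheet_domain q0 \<and>
          (\<lambda>k. snd (F x (k, lam k))) holomorphic_on sheet_domain q0)"

end

theory Submission
  imports Defs "HOL-Complex_Analysis.Complex_Analysis"
begin

text \<open>All four integral equations are Volterra equations on a half line \<open>(-\<infinity>, x]\<close>, after the reflection
  \<open>x \<mapsto> - x\<close> in the case of \<open>N\<close> and \<open>Nbar\<close>. If the kernel is dominated, locally uniformly in the
  spectral parameter, by an integrable function with integral \<open>W\<close>, then the \<open>n\<close>-th Picard iterate is
  \<open>O(W\<^sup>n / n!)\<close>, so the Neumann series converges locally uniformly and inherits continuity and
  holomorphy from the kernel. On the closed sheets \<open>Im \<lambda> \<ge> 0\<close> (respectively \<open>\<le> 0\<close>), so the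
  exponentials in the Green functions are bounded and the Green functions are \<open>O(1 / |\<lambda>|)\<close>, which
  suffices away from the branch points; they are also \<open>O(1 + |x - t|)\<close> uniformly up to
  \<open>\<lambda> = 0\<close>, and this growth is absorbed by the moment condition.\<close>

section \<open>Iterated integrals and parameter integrals\<close>

text \<open>The entries of Q - Q_- are q(x) - q_- and q(-x) - q_+. Both are integrable towards
  -\<infinity> only; at +\<infinity> they tend to q_+ - q_- and q_- - q_+. So in general there is no
  integrable majorant on the whole line: every estimate is for x \<le> x0 with a majorant depending
  on x0, which is enough because only t \<le> x enters the integral. The nonlocal entry q(-x) is
  also why each of the four equations sees the decay of q at both ends.

  A point of a closed sheet is a pair (k, \<lambda>), since the two edges of the cut share their k.
  Such a set has boundary points, so the two kinds of regularity are kept apart: continuity on a set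
  S of pairs, holomorphy along the section k \<mapsto> (k, \<sigma> \<open>lambda1 q0 k\<close>)
  over the cut plane. Both rest on one bound for the Picard terms that is uniform near each point of
  S.\<close>

fun iterated_mass :: "(real \<Rightarrow> ennreal) \<Rightarrow> nat \<Rightarrow> real \<Rightarrow> ennreal" where
  "iterated_mass w 0 x = 1"
| "iterated_mass w (Suc n) x = (\<integral>\<^sup>+t. w t * (if t \<le> x then 1 else 0) * iterated_mass w n t \<partial>lborel)"

lemma measurable_iterated_mass [measurable]:
  assumes [measurable]: "w \<in> borel_measurable borel"
  shows "iterated_mass w n \<in> borel_measurable borel"
proof (induction n)
  case 0
  then show ?case by simp
next
  case (Suc n)
  note [measurable] = Suc
  show ?case
    by (subst iterated_mass.simps(2)[abs_def]) measurable
qed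

text \<open>The square \<open>{s, t \<le> x}\<close> is cut along the diagonal; this replaces the fundamental theorem of
  calculus, which is not available for a merely integrable \<open>w\<close>.\<close>

lemma iterated_mass_step:
  assumes w [measurable]: "w \<in> borel_measurable borel"
  shows "iterated_mass w 1 x * iterated_mass w n x = of_nat (Suc n) * iterated_mass w (Suc n) x"
proof (induction n arbitrary: x)
  case 0
  then show ?case by simp
next
  case (Suc n)
  define u where "u s = w s * (if s \<le> x then 1 else 0)" for s :: real
  define v where "v t = u t * iterated_mass w n t" for t :: real
  have [measurable]: "u \<in> borel_measurable borel" unfolding u_def by measurable
  have [measurable]: "v \<in> borel_measurable borel" unfolding v_def by measurable
  have "iterated_mass w 1 x * iterated_mass w (Suc n) x = (\<integral>\<^sup>+s. u s \<partial>lborel) * (\<integral>\<^sup>+t. v t \<partial>lborel)"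
    by (simp add: u_def v_def)
  also have "\<dots> = (\<integral>\<^sup>+s. (\<integral>\<^sup>+t. u s * v t \<partial>lborel) \<partial>lborel)"
    by (simp add: nn_integral_cmult nn_integral_multc)
  also have "\<dots> = (\<integral>\<^sup>+s. (\<integral>\<^sup>+t. u s * v t * (if s \<le> t then 1 else 0) + u s * v t * (if t < s then 1 else 0) \<partial>lborel) \<partial>lborel)"
    by (intro nn_integral_cong) auto
  also have "\<dots> = (\<integral>\<^sup>+s. (\<integral>\<^sup>+t. u s * v t * (if s \<le> t then 1 else 0) \<partial>lborel) \<partial>lborel)
      + (\<integral>\<^sup>+s. (\<integral>\<^sup>+t. u s * v t * (if t < s then 1 else 0) \<partial>lborel) \<partial>lborel)"
    by (simp add: nn_integral_add)
  also have "(\<integral>\<^sup>+s. (\<integral>\<^sup>+t. u s * v t * (if s \<le> t then 1 else 0) \<partial>lborel) \<partial>lborel)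
     = (\<integral>\<^sup>+t. (\<integral>\<^sup>+s. u s * v t * (if s \<le> t then 1 else 0) \<partial>lborel) \<partial>lborel)"
    by (rule lborel_pair.Fubini'[symmetric]) measurable
  also have "\<dots> = (\<integral>\<^sup>+t. v t * (\<integral>\<^sup>+s. w s * (if s \<le> t then 1 else 0) \<partial>lborel) \<partial>lborel)"
  proof (intro nn_integral_cong)
    fix t :: real
    have "(\<integral>\<^sup>+s. u s * v t * (if s \<le> t then 1 else 0) \<partial>lborel) = (\<integral>\<^sup>+s. v t * (w s * (if s \<le> t then 1 else 0)) \<partial>lborel)"
      by (intro nn_integral_cong) (auto simp: u_def v_def mult_ac)
    then show "(\<integral>\<^sup>+s. u s * v t * (if s \<le> t then 1 else 0) \<partial>lborel) = v t * (\<integral>\<^sup>+s. w s * (if s \<le> t then 1 else 0) \<partial>lborel)"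
      by (simp add: nn_integral_cmult)
  qed
  \<comment> \<open>On s \<le> t the s-integral is the mass up to t, which the induction hypothesis
    at t merges with \<open>iterated_mass w n t\<close>. This half contributes n + 1 copies of the
    next iterate, the other half one more.\<close>
  also have "\<dots> = (\<integral>\<^sup>+t. of_nat (Suc n) * (u t * iterated_mass w (Suc n) t) \<partial>lborel)"
  proof (intro nn_integral_cong)
    fix t :: real
    have "v t * (\<integral>\<^sup>+s. w s * (if s \<le> t then 1 else 0) \<partial>lborel) = u t * (iterated_mass w 1 t * iterated_mass w n t)"
      by (simp add: v_def mult_ac)
    then show "v t * (\<integral>\<^sup>+s. w s * (if s \<le> t then 1 else 0) \<partial>lborel) = of_nat (Suc n) * (u t * iterated_mass w (Suc n) t)"
      by (simp only: Suc) (simp only: mult_ac)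
  qed
  also have "\<dots> = of_nat (Suc n) * iterated_mass w (Suc (Suc n)) x"
    by (subst nn_integral_cmult) (simp_all only: u_def iterated_mass.simps(2)[of w "Suc n"], measurable)
  also have "(\<integral>\<^sup>+s. (\<integral>\<^sup>+t. u s * v t * (if t < s then 1 else 0) \<partial>lborel) \<partial>lborel)
     = (\<integral>\<^sup>+s. u s * iterated_mass w (Suc n) s \<partial>lborel)"
  proof (intro nn_integral_cong)
    fix s :: real
    \<comment> \<open>Where \<open>u s\<close> is nonzero, t < s \<le> x makes the cutoff inside
      \<open>v\<close> redundant; discarding the null set t = s turns the strict inequality into the
      one in \<open>iterated_mass\<close>.\<close>
    have "(\<integral>\<^sup>+t. u s * v t * (if t < s then 1 else 0) \<partial>lborel)
        = (\<integral>\<^sup>+t. u s * (w t * (if t \<le> s then 1 else 0) * iterated_mass w n t) \<partial>lborel)"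
      by (rule nn_integral_cong_AE, use AE_lborel_singleton[of s] in eventually_elim)
         (auto simp: u_def v_def)
    then show "(\<integral>\<^sup>+t. u s * v t * (if t < s then 1 else 0) \<partial>lborel) = u s * iterated_mass w (Suc n) s"
      by (simp add: nn_integral_cmult)
  qed
  also have "(\<integral>\<^sup>+s. u s * iterated_mass w (Suc n) s \<partial>lborel) = iterated_mass w (Suc (Suc n)) x"
    by (simp only: u_def iterated_mass.simps(2)[of w "Suc n"])
  finally show ?case
    by (simp only: of_nat_Suc[of "Suc n"] distrib_right distrib_left mult_1 add.commute)
qed

text \<open>The ordered simplex is one of n! pieces of equal mass of the cube. Keeping
  \<open>fact n\<close> on the left avoids division in \<open>ennreal\<close>.\<close>

lemma iterated_mass_eq:
  assumes "w \<in> borel_measurable borel"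
  shows "fact n * iterated_mass w n x = iterated_mass w 1 x ^ n"
proof (induction n)
  case 0
  then show ?case by simp
next
  case (Suc n)
  have "fact (Suc n) * iterated_mass w (Suc n) x = fact n * (of_nat (Suc n) * iterated_mass w (Suc n) x)"
    by (simp only: fact_Suc mult_ac)
  also have "\<dots> = iterated_mass w 1 x * (fact n * iterated_mass w n x)"
    by (simp only: iterated_mass_step[OF assms, symmetric] mult_ac)
  also have "\<dots> = iterated_mass w 1 x ^ Suc n"
    by (simp only: Suc power_Suc)
  finally show ?case .
qed

lemma iterated_mass_le:
  fixes w :: "real \<Rightarrow> real"
  assumes w: "integrable lborel w" "\<And>t. 0 \<le> w t"
  shows "iterated_mass (\<lambda>t. ennreal (w t)) n x \<le> ennreal ((\<integral>t. w t \<partial>lborel) ^ n / fact n)"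
proof -
  define W where "W = (\<integral>t. w t \<partial>lborel)"
  have W0: "W \<ge> 0" unfolding W_def using w by (intro integral_nonneg_AE) auto
  have meas: "(\<lambda>t. ennreal (w t)) \<in> borel_measurable borel"
    using borel_measurable_integrable[OF w(1)] by simp
  have "iterated_mass (\<lambda>t. ennreal (w t)) 1 x \<le> (\<integral>\<^sup>+t. ennreal (w t) \<partial>lborel)"
    by (simp, intro nn_integral_mono) auto
  also have "\<dots> = ennreal W" unfolding W_def using w by (intro nn_integral_eq_integral) auto
  finally have le: "fact n * iterated_mass (\<lambda>t. ennreal (w t)) n x \<le> ennreal W ^ n"
    unfolding iterated_mass_eq[OF meas] by (intro power_mono) auto
  have fct: "ennreal (fact n) = fact n"
    by (metis ennreal_of_nat_eq_real_of_nat of_nat_fact)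
  from le have *: "ennreal (fact n) * iterated_mass (\<lambda>t. ennreal (w t)) n x \<le> ennreal (W ^ n)"
    using W0 by (simp only: fct ennreal_power)
  have inv: "ennreal (1 / fact n) * ennreal (fact n) = 1"
    by (subst ennreal_mult[symmetric]) auto
  have "iterated_mass (\<lambda>t. ennreal (w t)) n x
      = ennreal (1 / fact n) * (ennreal (fact n) * iterated_mass (\<lambda>t. ennreal (w t)) n x)"
    by (simp only: mult.assoc[symmetric] inv mult_1)
  also have "\<dots> \<le> ennreal (1 / fact n) * ennreal (W ^ n)"
    by (rule mult_left_mono[OF *]) simp
  also have "\<dots> = ennreal (W ^ n / fact n)"
    using W0 by (subst ennreal_mult[symmetric]) auto
  finally show ?thesis unfolding W_def .
qed

section \<open>Holomorphy of integrals depending on a complex parameter\<close>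

lemma holomorphic_on_integral:
  fixes g :: "complex \<Rightarrow> 'a \<Rightarrow> complex"
  assumes "open D"
    and meas: "\<And>z. z \<in> D \<Longrightarrow> g z \<in> borel_measurable M"
    and hol: "\<And>t. t \<in> space M \<Longrightarrow> (\<lambda>z. g z t) holomorphic_on D"
    and dom: "\<And>a. a \<in> D \<Longrightarrow> \<exists>r>0. \<exists>w. integrable M w \<and>
      (\<forall>z\<in>ball a r \<inter> D. \<forall>t\<in>space M. norm (g z t) \<le> w t)"
  shows "(\<lambda>z. \<integral>t. g z t \<partial>M) holomorphic_on D"
  unfolding holomorphic_on_open[OF \<open>open D\<close>]
proof
  fix a assume a: "a \<in> D"
  obtain r1 w where r1: "r1 > 0" and w: "integrable M w"
    and bd: "\<And>z t. z \<in> ball a r1 \<inter> D \<Longrightarrow> t \<in> space M \<Longrightarrow> norm (g z t) \<le> w t"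
    using dom[OF a] by blast
  obtain r2 where r2: "r2 > 0" "ball a r2 \<subseteq> D"
    using a \<open>open D\<close> openE by blast
  \<comment> \<open>The factor 4 leaves room for Cauchy's inequality: a disc of radius
    \<open>r\<close> about any point of \<open>ball a r\<close> lies in
    \<open>cball a (2 * r)\<close>, hence in both neighbourhoods.\<close>
  define r where "r = min r1 r2 / 4"
  have r: "r > 0" and sub: "cball a (2 * r) \<subseteq> ball a r1 \<inter> D"
    using r1 r2 unfolding r_def by (auto simp: subset_iff)
  \<comment> \<open>Cauchy's inequality bounds the difference quotients by an integrable function, so that
    dominated convergence applies to them.\<close>
  have lip: "norm (g z t - g a t) \<le> w t / r * norm (z - a)"
    if z: "z \<in> ball a r" and t: "t \<in> space M" for z t
  proof (rule field_differentiable_bound[of "ball a r" _ "\<lambda>z. deriv (\<lambda>z. g z t) z"])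
    fix y assume y: "y \<in> ball a r"
    have ysub: "cball y r \<subseteq> cball a (2 * r)"
    proof
      fix u assume "u \<in> cball y r"
      then show "u \<in> cball a (2 * r)"
        using y dist_triangle[of a u y] by auto
    qed
    then have yD: "cball y r \<subseteq> D" using sub by blast
    have "y \<in> D" using yD r by auto
    then show "((\<lambda>z. g z t) has_field_derivative deriv (\<lambda>z. g z t) y) (at y within ball a r)"
      using hol[OF t] \<open>open D\<close> holomorphic_derivI by blast
    have h: "(\<lambda>z. g z t) holomorphic_on cball y r"
      using hol[OF t] yD holomorphic_on_subset by blast
    have "norm ((deriv ^^ 1) (\<lambda>z. g z t) y) \<le> fact 1 * w t / r ^ 1"
    proof (rule Cauchy_inequality)
      fix u assume "norm (y - u) = r"
      then have "u \<in> cball y r" by (simp add: dist_norm)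
      then show "norm (g u t) \<le> w t" using bd ysub sub t by blast
    qed (use h r in \<open>auto intro: holomorphic_on_imp_continuous_on holomorphic_on_subset\<close>)
    then show "norm (deriv (\<lambda>z. g z t) y) \<le> w t / r" by simp
  qed (use z r in auto)
  define h where "h t = deriv (\<lambda>z. g z t) a" for t
  have aint: "integrable M (g z)" if "z \<in> ball a r" for z
    using that sub r
    by (intro Bochner_Integration.integrable_bound[OF w meas] AE_I2 order_trans[OF bd])
       (auto simp: subset_iff)
  have ev: "\<forall>\<^sub>F n in sequentially. X n \<in> ball a r \<and> X n \<noteq> a"
    if X: "\<forall>n. X n \<in> UNIV - {a}" "X \<longlonglongrightarrow> a" for X :: "nat \<Rightarrow> complex"
    using topological_tendstoD[OF X(2), of "ball a r"] X(1) r by (auto elim: eventually_mono)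
  have dq: "(\<lambda>n. (g (X n) t - g a t) / (X n - a)) \<longlonglongrightarrow> h t"
    if X: "\<forall>n. X n \<in> UNIV - {a}" "X \<longlonglongrightarrow> a" and t: "t \<in> space M" for X :: "nat \<Rightarrow> complex" and t
  proof -
    have "((\<lambda>z. g z t) has_field_derivative h t) (at a)"
      unfolding h_def using hol[OF t] \<open>open D\<close> a holomorphic_derivI by blast
    then show ?thesis
      using X unfolding has_field_derivative_iff tendsto_at_iff_sequentially by (auto simp: comp_def)
  qed
  have lim: "(\<lambda>n. ((\<integral>t. g (X n) t \<partial>M) - (\<integral>t. g a t \<partial>M)) / (X n - a)) \<longlonglongrightarrow> (\<integral>t. h t \<partial>M)"
    if X: "\<forall>n. X n \<in> UNIV - {a}" "X \<longlonglongrightarrow> a" for X :: "nat \<Rightarrow> complex"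
  proof -
    \<comment> \<open>Dominated convergence wants the bound for every term, but the sequence lies in
      \<open>ball a r\<close> only eventually; hence the shift by \<open>N\<close>, undone by
      \<open>LIMSEQ_offset\<close>.\<close>
    obtain N where N: "\<And>n. n \<ge> N \<Longrightarrow> X n \<in> ball a r \<and> X n \<noteq> a"
      using ev[OF X] unfolding eventually_sequentially by blast
    let ?Y = "\<lambda>n. X (n + N)"
    have Y: "\<forall>n. ?Y n \<in> UNIV - {a}" "?Y \<longlonglongrightarrow> a"
      using X LIMSEQ_ignore_initial_segment by blast+
    have mY: "(\<lambda>t. (g (?Y n) t - g a t) / (?Y n - a)) \<in> borel_measurable M" for n
      using aint[of "?Y n"] aint[of a] N[of "n + N"] r
      by (intro borel_measurable_divide borel_measurable_diff borel_measurable_const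
           borel_measurable_integrable) auto
    have "(\<lambda>n. \<integral>t. (g (?Y n) t - g a t) / (?Y n - a) \<partial>M) \<longlonglongrightarrow> (\<integral>t. h t \<partial>M)"
    proof (rule integral_dominated_convergence[where w = "\<lambda>t. w t / r"])
      \<comment> \<open>The derivative inherits measurability in t as a pointwise limit of
        difference quotients.\<close>
      show "h \<in> borel_measurable M"
        by (rule borel_measurable_LIMSEQ_metric[OF mY dq[OF Y]])
      show "integrable M (\<lambda>t. w t / r)" using w by simp
      show "AE t in M. (\<lambda>n. (g (?Y n) t - g a t) / (?Y n - a)) \<longlonglongrightarrow> h t"
        using dq[OF Y] by auto
      show "AE t in M. norm ((g (?Y n) t - g a t) / (?Y n - a)) \<le> w t / r" for n
      proof (rule AE_I2)
        fix t assume "t \<in> space M"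
        then have "norm (g (?Y n) t - g a t) \<le> w t / r * norm (?Y n - a)"
          using lip N[of "n + N"] by simp
        moreover have "norm (?Y n - a) > 0" using N[of "n + N"] by simp
        ultimately show "norm ((g (?Y n) t - g a t) / (?Y n - a)) \<le> w t / r"
          by (simp add: norm_divide divide_le_eq)
      qed
    qed (use mY in auto)
    moreover have "(\<integral>t. (g (?Y n) t - g a t) / (?Y n - a) \<partial>M)
        = ((\<integral>t. g (?Y n) t \<partial>M) - (\<integral>t. g a t \<partial>M)) / (?Y n - a)" for n
      using aint[of "?Y n"] aint[of a] N[of "n + N"] r by simp
    ultimately have "(\<lambda>n. ((\<integral>t. g (?Y n) t \<partial>M) - (\<integral>t. g a t \<partial>M)) / (?Y n - a)) \<longlonglongrightarrow> (\<integral>t. h t \<partial>M)"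
      by (simp only:)
    then show ?thesis by (rule LIMSEQ_offset)
  qed
  show "\<exists>f'. ((\<lambda>z. \<integral>t. g z t \<partial>M) has_field_derivative f') (at a)"
    using lim unfolding has_field_derivative_iff tendsto_at_iff_sequentially by (auto simp: comp_def)
qed

section \<open>Volterra equations with a parameter\<close>

text \<open>In \<open>dominated\<close> the majorant may change with \<open>x0\<close> and with the
  neighbourhood of \<open>p\<close>. \<open>measurable_T\<close> is joint in x and t, so that
  integrating out t leaves a measurable function of x; \<open>continuous_T\<close> allows the
  argument to move with p, as it does in the induction over the Picard terms.\<close>

locale volterra =
  fixes S :: "'p::metric_space set"
    and T :: "'p \<Rightarrow> real \<Rightarrow> real \<Rightarrow> 'v \<Rightarrow> 'v::{banach, second_countable_topology}"
    and F0 :: "'p \<Rightarrow> 'v"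
  assumes causal: "p \<in> S \<Longrightarrow> x < t \<Longrightarrow> T p x t v = 0"
    and linear: "p \<in> S \<Longrightarrow> bounded_linear (T p x t)"
    and measurable_T: "p \<in> S \<Longrightarrow> h \<in> borel_measurable borel \<Longrightarrow>
      (\<lambda>(x, t). T p x t (h t)) \<in> borel_measurable (borel \<Otimes>\<^sub>M borel)"
    and continuous_T: "continuous_on S g \<Longrightarrow> continuous_on S (\<lambda>p. T p x t (g p))"
    and dominated: "p \<in> S \<Longrightarrow> \<exists>U w. open U \<and> p \<in> U \<and> integrable lborel w \<and> (\<forall>t. 0 \<le> w t) \<and>
      (\<forall>p'\<in>U \<inter> S. \<forall>x\<le>x0. \<forall>t\<le>x. \<forall>v. norm (T p' x t v) \<le> w t * norm v)"
    and continuous_F0: "continuous_on S F0"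
begin

text \<open>The n-th term of the Neumann series, that is, the difference of two successive
  approximations and not the approximation itself.\<close>

fun picard :: "nat \<Rightarrow> real \<Rightarrow> 'p \<Rightarrow> 'v" where
  "picard 0 x p = F0 p"
| "picard (Suc n) x p = (\<integral>t. T p x t (picard n t p) \<partial>lborel)"

definition solution :: "real \<Rightarrow> 'p \<Rightarrow> 'v" where
  "solution x p = (\<Sum>n. picard n x p)"

lemma measurable_section:
  assumes "p \<in> S" "h \<in> borel_measurable borel"
  shows "(\<lambda>t. T p x t (h t)) \<in> borel_measurable borel"
proof -
  have "(\<lambda>t. (x, t)) \<in> borel \<rightarrow>\<^sub>M borel \<Otimes>\<^sub>M borel" by measurable
  from measurable_compose[OF this measurable_T[OF assms]] show ?thesis by simp
qed

lemma measurable_picard: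
  assumes "p \<in> S"
  shows "(\<lambda>x. picard n x p) \<in> borel_measurable borel"
proof (induction n)
  case 0
  then show ?case by simp
next
  case (Suc n)
  have "(\<lambda>x. \<integral>t. T p x t (picard n t p) \<partial>lborel) \<in> borel_measurable borel"
    using measurable_T[OF assms Suc]
    by (intro lborel.borel_measurable_lebesgue_integral) (simp cong: measurable_cong_sets sets_pair_measure_cong)
  then show ?case by simp
qed

lemma picard_bound:
  assumes p: "p \<in> S"
    and w: "integrable lborel w" "\<And>t. 0 \<le> w t"
    and dom: "\<And>x t v. x \<le> x0 \<Longrightarrow> t \<le> x \<Longrightarrow> norm (T p x t v) \<le> w t * norm v"
    and x: "x \<le> x0"
  shows "norm (picard n x p) \<le> norm (F0 p) * ((\<integral>t. w t \<partial>lborel) ^ n / fact n)"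
proof -
  have W0: "(\<integral>t. w t \<partial>lborel) \<ge> 0" using w by (intro integral_nonneg_AE) auto
  have [measurable]: "w \<in> borel_measurable borel" using borel_measurable_integrable[OF w(1)] by simp
  have [measurable]: "iterated_mass (\<lambda>t. ennreal (w t)) n \<in> borel_measurable borel" for n
    by (rule measurable_iterated_mass) measurable
  have "ennreal (norm (picard n x p)) \<le> ennreal (norm (F0 p)) * iterated_mass (\<lambda>t. ennreal (w t)) n x"
    using x
  proof (induction n arbitrary: x)
    case 0
    then show ?case by simp
  next
    case (Suc n)
    \<comment> \<open>Integrability of the integrand is deduced later from this very bound. Should
      it fail, the Bochner integral is 0 by convention and the inequality is trivial.\<close>
    have "ennreal (norm (picard (Suc n) x p)) \<le> (\<integral>\<^sup>+t. norm (T p x t (picard n t p)) \<partial>lborel)"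
      by (cases "integrable lborel (\<lambda>t. T p x t (picard n t p))")
         (auto simp: integral_norm_bound_ennreal not_integrable_integral_eq)
    also have "\<dots> \<le> (\<integral>\<^sup>+t. ennreal (norm (F0 p)) *
        (ennreal (w t) * (if t \<le> x then 1 else 0) * iterated_mass (\<lambda>t. ennreal (w t)) n t) \<partial>lborel)"
    proof (rule nn_integral_mono)
      fix t
      show "ennreal (norm (T p x t (picard n t p))) \<le> ennreal (norm (F0 p)) *
        (ennreal (w t) * (if t \<le> x then 1 else 0) * iterated_mass (\<lambda>t. ennreal (w t)) n t)"
      proof (cases "t \<le> x")
        case True
        have "ennreal (norm (T p x t (picard n t p))) \<le> ennreal (w t * norm (picard n t p))"
          using dom[OF Suc.prems True] by (rule ennreal_leI)
        also have "\<dots> = ennreal (w t) * ennreal (norm (picard n t p))"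
          using w(2) by (simp add: ennreal_mult)
        also have "\<dots> \<le> ennreal (w t) * (ennreal (norm (F0 p)) * iterated_mass (\<lambda>t. ennreal (w t)) n t)"
          using Suc.IH[of t] True Suc.prems by (intro mult_left_mono) auto
        finally show ?thesis using True by (simp add: mult_ac)
      qed (use causal[OF p] in simp)
    qed
    also have "\<dots> = ennreal (norm (F0 p)) * iterated_mass (\<lambda>t. ennreal (w t)) (Suc n) x"
      by (subst nn_integral_cmult) (simp_all only: iterated_mass.simps, measurable)
    finally show ?case .
  qed
  also have "\<dots> \<le> ennreal (norm (F0 p)) * ennreal ((\<integral>t. w t \<partial>lborel) ^ n / fact n)"
    by (intro mult_left_mono iterated_mass_le w) auto
  also have "\<dots> = ennreal (norm (F0 p) * ((\<integral>t. w t \<partial>lborel) ^ n / fact n))"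
    using W0 by (subst ennreal_mult) auto
  finally show ?thesis using W0 by (subst (asm) ennreal_le_iff) auto
qed

text \<open>Uniformity near \<open>p\<close> serves dominated convergence and holomorphy in the
  parameter; the explicit dependence on \<open>n\<close>, with \<open>B\<close> and \<open>W\<close>
  fixed, serves the summation of the series.\<close>

lemma local_bounds:
  assumes "p \<in> S"
  obtains U w B W where "open U" "p \<in> U" "integrable lborel w"
    "\<And>p' y n. p' \<in> U \<Longrightarrow> p' \<in> S \<Longrightarrow> y \<le> x \<Longrightarrow> norm (picard n y p') \<le> B * (W ^ n / fact n)"
    "\<And>p' t n. p' \<in> U \<Longrightarrow> p' \<in> S \<Longrightarrow> norm (T p' x t (picard n t p')) \<le> w t * (B * (W ^ n / fact n))"
proof -
  from dominated[OF assms, of x] obtain U w where U: "open U" "p \<in> U"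
    and w: "integrable lborel w" "\<forall>t. 0 \<le> w t"
    and dom': "\<forall>p'\<in>U \<inter> S. \<forall>y\<le>x. \<forall>t\<le>y. \<forall>v. norm (T p' y t v) \<le> w t * norm v"
    by (elim exE conjE) (rule that)
  have dom: "norm (T p' y t v) \<le> w t * norm v"
    if "p' \<in> U" "p' \<in> S" "y \<le> x" "t \<le> y" for p' y t v
    using dom' that by simp
  define W where "W = (\<integral>t. w t \<partial>lborel)"
  \<comment> \<open>The extra 1 covers the variation of \<open>F0\<close> on the neighbourhood
    \<open>V\<close>, where it stays within distance 1 of \<open>F0 p\<close>.\<close>
  define B where "B = norm (F0 p) + 1"
  have W0: "W \<ge> 0" unfolding W_def using w by (intro integral_nonneg_AE) auto
  have B0: "B \<ge> 0" by (simp add: B_def)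
  obtain V where V: "open V" "p \<in> V" "\<And>p'. p' \<in> V \<Longrightarrow> p' \<in> S \<Longrightarrow> F0 p' \<in> ball (F0 p) 1"
    using continuous_F0[unfolded continuous_on_topological, rule_format, OF assms open_ball[of "F0 p" 1]]
    by auto
  have F0: "norm (F0 p') \<le> B" if "p' \<in> V" "p' \<in> S" for p'
    using V(3)[OF that] norm_triangle_ineq2[of "F0 p'" "F0 p"]
    by (simp add: B_def dist_norm norm_minus_commute)
  have bd: "norm (picard n y p') \<le> B * (W ^ n / fact n)"
    if "p' \<in> U \<inter> V" "p' \<in> S" "y \<le> x" for p' y n
  proof -
    have "norm (picard n y p') \<le> norm (F0 p') * (W ^ n / fact n)"
      unfolding W_def using that w dom by (intro picard_bound[where ?x0.0 = x]) auto
    also have "\<dots> \<le> B * (W ^ n / fact n)"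
      using F0[of p'] that W0 by (intro mult_right_mono) auto
    finally show ?thesis .
  qed
  show ?thesis
  proof (rule that[of "U \<inter> V" w B W])
    show "norm (T p' x t (picard n t p')) \<le> w t * (B * (W ^ n / fact n))"
      if p': "p' \<in> U \<inter> V" "p' \<in> S" for p' t n
    proof (cases "t \<le> x")
      case True
      have "norm (T p' x t (picard n t p')) \<le> w t * norm (picard n t p')"
        using dom p' True by auto
      also have "\<dots> \<le> w t * (B * (W ^ n / fact n))"
        using bd[OF p' True] w(2) by (intro mult_left_mono) auto
      finally show ?thesis .
    next
      case False
      have "0 \<le> w t * (B * (W ^ n / fact n))"
        using w B0 W0 by (intro mult_nonneg_nonneg divide_nonneg_nonneg zero_le_power) auto
      then show ?thesis using causal[OF p'(2), of x t] False by (simp del: times_divide_eq_right)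
    qed
  qed (use U V w bd in auto)
qed

lemma summable_majorant: "summable (\<lambda>n. B * (W ^ n / fact n :: real))"
  by (intro summable_mult) (simp only: divide_inverse mult.commute[of "W ^ _"] summable_exp)

lemma integrable_picard:
  assumes "p \<in> S"
  shows "integrable lborel (\<lambda>t. T p x t (picard n t p))"
proof -
  obtain U w B W where *: "p \<in> U" "integrable lborel w"
    "\<And>p' t n. p' \<in> U \<Longrightarrow> p' \<in> S \<Longrightarrow> norm (T p' x t (picard n t p')) \<le> w t * (B * (W ^ n / fact n))"
    using local_bounds[OF assms, of x] by metis
  show ?thesis
  proof (rule Bochner_Integration.integrable_bound)
    show "integrable lborel (\<lambda>t. w t * (B * (W ^ n / fact n)))"
      by (intro integrable_mult_left *(2))
    show "(\<lambda>t. T p x t (picard n t p)) \<in> borel_measurable lborel"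
      using measurable_section[OF assms measurable_picard[OF assms]] by simp
    show "AE t in lborel. norm (T p x t (picard n t p)) \<le> norm (w t * (B * (W ^ n / fact n)))"
      unfolding real_norm_def by (intro AE_I2 order_trans[OF *(3)[OF *(1) assms]] abs_ge_self)
  qed
qed

lemma solution_solves:
  assumes p: "p \<in> S"
  shows "integrable lborel (\<lambda>t. T p x t (solution t p))"
    and "solution x p = F0 p + (\<integral>t. T p x t (solution t p) \<partial>lborel)"
proof -
  obtain U w B W where *: "p \<in> U" "integrable lborel w"
    "\<And>p' y n. p' \<in> U \<Longrightarrow> p' \<in> S \<Longrightarrow> y \<le> x \<Longrightarrow> norm (picard n y p') \<le> B * (W ^ n / fact n)"
    "\<And>p' t n. p' \<in> U \<Longrightarrow> p' \<in> S \<Longrightarrow> norm (T p' x t (picard n t p')) \<le> w t * (B * (W ^ n / fact n))"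
    using local_bounds[OF p, of x] by metis
  note bd = *(4)[OF *(1) p]
  have summ: "summable (\<lambda>n. picard n y p)" if "y \<le> x" for y
    by (rule summable_comparison_test'[OF summable_majorant[of B W], of 0]) (use * p that in auto)
  \<comment> \<open>The Picard series is controlled only up to \<open>x\<close>; for t > x both
    sides vanish by causality, so nothing is asked of the series there.\<close>
  have series: "T p x t (solution t p) = (\<Sum>n. T p x t (picard n t p))" for t
  proof (cases "t \<le> x")
    case True
    then show ?thesis unfolding solution_def
      by (intro bounded_linear.suminf[OF linear[OF p]] summ)
  qed (use causal p in simp)
  have 1: "AE t in lborel. summable (\<lambda>n. norm (T p x t (picard n t p)))"
    by (intro AE_I2 summable_comparison_test'[OF summable_mult[OF summable_majorant[of B W]], of 0])
       (use bd in auto)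
  \<comment> \<open>Exchanging sum and integral needs summable L1 norms; the n-th is at most the
    mass of \<open>w\<close> times the n-th term of an exponential series.\<close>
  have 2: "summable (\<lambda>n. \<integral>t. norm (T p x t (picard n t p)) \<partial>lborel)"
  proof (rule summable_comparison_test'[OF summable_mult[OF summable_majorant[of B W], of "\<integral>t. w t \<partial>lborel"], of 0])
    fix n
    have "(\<integral>t. norm (T p x t (picard n t p)) \<partial>lborel) \<le> (\<integral>t. w t * (B * (W ^ n / fact n)) \<partial>lborel)"
      by (intro integral_mono integrable_norm integrable_picard p bd integrable_mult_left *(2))
    then show "norm (\<integral>t. norm (T p x t (picard n t p)) \<partial>lborel) \<le> (\<integral>t. w t \<partial>lborel) * (B * (W ^ n / fact n))"
      by (simp add: integral_nonneg_AE)
  qed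
  note int = integrable_picard[OF p]
  show "integrable lborel (\<lambda>t. T p x t (solution t p))"
    unfolding series by (rule integrable_suminf[OF int 1 2])
  have "solution x p = picard 0 x p + (\<Sum>n. picard (Suc n) x p)"
    unfolding solution_def using summ[of x] suminf_split_head[of "\<lambda>n. picard n x p"] by simp
  also have "(\<Sum>n. picard (Suc n) x p) = (\<integral>t. T p x t (solution t p) \<partial>lborel)"
    unfolding series by (simp add: integral_suminf[OF int 1 2])
  finally show "solution x p = F0 p + (\<integral>t. T p x t (solution t p) \<partial>lborel)"
    by simp
qed

lemma continuous_picard: "continuous_on S (picard n x)"
proof (induction n arbitrary: x)
  case 0
  then show ?case using continuous_F0 by (simp cong: continuous_on_cong)
next
  case (Suc n)
  show ?case
  proof (rule continuous_on_sequentiallyI)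
    fix u a assume u: "\<forall>n. u n \<in> S" and a: "a \<in> S" and lim: "u \<longlonglongrightarrow> a"
    obtain U w B W where *: "open U" "a \<in> U" "integrable lborel w"
      "\<And>p' t n. p' \<in> U \<Longrightarrow> p' \<in> S \<Longrightarrow> norm (T p' x t (picard n t p')) \<le> w t * (B * (W ^ n / fact n))"
      using local_bounds[OF a, of x] by metis
    obtain N where N: "\<And>m. m \<ge> N \<Longrightarrow> u m \<in> U"
      using topological_tendstoD[OF lim *(1,2)] unfolding eventually_sequentially by blast
    have "(\<lambda>m. picard (Suc n) x (u (m + N))) \<longlonglongrightarrow> picard (Suc n) x a"
      unfolding picard.simps
    proof (rule integral_dominated_convergence)
      show "integrable lborel (\<lambda>t. w t * (B * (W ^ n / fact n)))"
        by (intro integrable_mult_left *)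
      show "(\<lambda>t. T a x t (picard n t a)) \<in> borel_measurable lborel"
        using measurable_section[OF a measurable_picard[OF a]] by simp
      show "(\<lambda>t. T (u (m + N)) x t (picard n t (u (m + N)))) \<in> borel_measurable lborel" for m
        using measurable_section[OF _ measurable_picard, of "u (m + N)"] u by simp
      \<comment> \<open>The induction hypothesis enters here: \<open>picard n t\<close> is
        continuous on \<open>S\<close>, so \<open>continuous_T\<close> lets kernel and argument
        converge together.\<close>
      have "(\<lambda>m. T (u (m + N)) x t (picard n t (u (m + N)))) \<longlonglongrightarrow> T a x t (picard n t a)" for t
        using continuous_on_tendsto_compose[OF continuous_T[OF Suc, of x t t] LIMSEQ_ignore_initial_segment[OF lim] a] u
        by simp
      then show "AE t in lborel. (\<lambda>m. T (u (m + N)) x t (picard n t (u (m + N)))) \<longlonglongrightarrow> T a x t (picard n t a)"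
        by simp
      show "AE t in lborel. norm (T (u (m + N)) x t (picard n t (u (m + N)))) \<le> w t * (B * (W ^ n / fact n))" for m
        using *(4)[of "u (m + N)"] N[of "m + N"] u by (intro AE_I2) simp
    qed
    then show "(\<lambda>m. picard (Suc n) x (u m)) \<longlonglongrightarrow> picard (Suc n) x a"
      by (rule LIMSEQ_offset)
  qed
qed

text \<open>The neighbourhood supplied by \<open>local_bounds\<close> does not depend on n, so the
  Weierstrass M-test applies with an exponential series as majorant.\<close>

lemma uniform_limit_solution:
  assumes "p \<in> S"
  obtains U where "open U" "p \<in> U"
    "uniform_limit (U \<inter> S) (\<lambda>n p'. \<Sum>i<n. picard i x p') (solution x) sequentially"
proof -
  obtain U B W where *: "open U" "p \<in> U"
    "\<And>p' y n. p' \<in> U \<Longrightarrow> p' \<in> S \<Longrightarrow> y \<le> x \<Longrightarrow> norm (picard n y p') \<le> B * (W ^ n / fact n)"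
    using local_bounds[OF assms, of x] by metis
  have "uniform_limit (U \<inter> S) (\<lambda>n p'. \<Sum>i<n. picard i x p') (\<lambda>p'. \<Sum>i. picard i x p') sequentially"
    by (rule Weierstrass_m_test[OF _ summable_majorant[of B W]]) (use * in auto)
  then show ?thesis using * that unfolding solution_def[abs_def] by blast
qed

lemma continuous_solution: "continuous_on S (solution x)"
  unfolding continuous_on_def
proof
  fix p assume p: "p \<in> S"
  obtain U where U: "open U" "p \<in> U"
    "uniform_limit (U \<inter> S) (\<lambda>n p'. \<Sum>i<n. picard i x p') (solution x) sequentially"
    using uniform_limit_solution[OF p] .
  have "continuous_on (U \<inter> S) (solution x)"
    by (rule uniform_limit_theorem[OF _ U(3)])
       (auto intro!: always_eventually continuous_on_sum continuous_on_subset[OF continuous_picard])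
  moreover have "at p within (U \<inter> S) = at p within S"
    using U by (intro at_within_nhd[of p U]) auto
  ultimately show "(solution x \<longlongrightarrow> solution x p) (at p within S)"
    using p U(2) unfolding continuous_on_def by (metis IntI)
qed

end

text \<open>Holomorphy is asked only after pulling back along \<open>c\<close>, because
  \<open>S\<close> may contain boundary points. The components appear separately since
  \<open>holomorphic_on\<close> concerns complex-valued functions.\<close>

locale holomorphic_volterra = volterra S T F0
  for S :: "'p::metric_space set"
    and T :: "'p \<Rightarrow> real \<Rightarrow> real \<Rightarrow> complex \<times> complex \<Rightarrow> complex \<times> complex" and F0 +
  fixes D :: "complex set" and c :: "complex \<Rightarrow> 'p"
  assumes open_D: "open D"
    and c_in: "z \<in> D \<Longrightarrow> c z \<in> S"
    and continuous_c: "continuous_on D c"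
    and holomorphic_T: "(\<lambda>z. fst (h z)) holomorphic_on D \<Longrightarrow> (\<lambda>z. snd (h z)) holomorphic_on D \<Longrightarrow>
      (\<lambda>z. fst (T (c z) x t (h z))) holomorphic_on D \<and> (\<lambda>z. snd (T (c z) x t (h z))) holomorphic_on D"
    and holomorphic_F0: "(\<lambda>z. fst (F0 (c z))) holomorphic_on D" "(\<lambda>z. snd (F0 (c z))) holomorphic_on D"
begin

lemma holomorphic_picard:
  "(\<lambda>z. fst (picard n x (c z))) holomorphic_on D \<and> (\<lambda>z. snd (picard n x (c z))) holomorphic_on D"
proof (induction n arbitrary: x)
  case 0
  then show ?case using holomorphic_F0 by simp
next
  case (Suc n)
  \<comment> \<open>\<open>\<pi>\<close> stands for \<open>fst\<close> or \<open>snd\<close>: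
    bounded linear, hence commuting with the integral, and norm-decreasing, hence keeping the
    majorant.\<close>
  have proj: "(\<lambda>z. \<integral>t. \<pi> (T (c z) x t (picard n t (c z))) \<partial>lborel) holomorphic_on D"
    if \<pi>: "bounded_linear \<pi>" "\<And>v. norm (\<pi> v) \<le> norm v"
      "\<And>t. (\<lambda>z. \<pi> (T (c z) x t (picard n t (c z)))) holomorphic_on D" for \<pi> :: "complex \<times> complex \<Rightarrow> complex"
  proof (rule holomorphic_on_integral[OF open_D])
    show "(\<lambda>t. \<pi> (T (c z) x t (picard n t (c z)))) \<in> borel_measurable lborel" if "z \<in> D" for z
      using integrable_bounded_linear[OF \<pi>(1) integrable_picard[OF c_in[OF that], of x n]]
      by (rule borel_measurable_integrable)
    fix a assume a: "a \<in> D"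
    obtain U w B W where *: "open U" "c a \<in> U" "integrable lborel w"
      "\<And>p' t n. p' \<in> U \<Longrightarrow> p' \<in> S \<Longrightarrow> norm (T p' x t (picard n t p')) \<le> w t * (B * (W ^ n / fact n))"
      using local_bounds[OF c_in[OF a], of x] by metis
    obtain V where V: "open V" "a \<in> V" "\<And>z. z \<in> V \<Longrightarrow> z \<in> D \<Longrightarrow> c z \<in> U"
      using continuous_c a *(1,2) unfolding continuous_on_topological by metis
    obtain r where r: "r > 0" "ball a r \<subseteq> V" using V openE by blast
    show "\<exists>r>0. \<exists>w. integrable lborel w \<and>
      (\<forall>z\<in>ball a r \<inter> D. \<forall>t\<in>space lborel. norm (\<pi> (T (c z) x t (picard n t (c z)))) \<le> w t)"
    proof (intro exI conjI ballI)
      show "integrable lborel (\<lambda>t. w t * (B * (W ^ n / fact n)))"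
        by (intro integrable_mult_left *)
      fix z t assume z: "z \<in> ball a r \<inter> D"
      then have cz: "c z \<in> U" "c z \<in> S" using V(3) r c_in by auto
      show "norm (\<pi> (T (c z) x t (picard n t (c z)))) \<le> w t * (B * (W ^ n / fact n))"
        using \<pi>(2) *(4)[OF cz] order_trans by blast
    qed (use r in auto)
  qed (use \<pi>(3) in blast)
  have comm: "\<pi> (picard (Suc n) x (c z)) = (\<integral>t. \<pi> (T (c z) x t (picard n t (c z))) \<partial>lborel)"
    if "bounded_linear \<pi>" "z \<in> D" for \<pi> :: "complex \<times> complex \<Rightarrow> complex" and z
    using integral_bounded_linear[OF that(1) integrable_picard[OF c_in[OF that(2)]]] by simp
  have T: "(\<lambda>z. fst (T (c z) x t (picard n t (c z)))) holomorphic_on D \<and>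
      (\<lambda>z. snd (T (c z) x t (picard n t (c z)))) holomorphic_on D" for t
    using holomorphic_T[of "\<lambda>z. picard n t (c z)"] Suc by blast
  have "(\<lambda>z. fst (picard (Suc n) x (c z))) holomorphic_on D"
    by (rule holomorphic_transform[OF proj[of fst]])
       (use T in \<open>auto intro: bounded_linear_fst norm_fst_le simp: comm[OF bounded_linear_fst, symmetric] simp del: picard.simps\<close>)
  moreover have "(\<lambda>z. snd (picard (Suc n) x (c z))) holomorphic_on D"
    by (rule holomorphic_transform[OF proj[of snd]])
       (use T in \<open>auto intro: bounded_linear_snd norm_snd_le simp: comm[OF bounded_linear_snd, symmetric] simp del: picard.simps\<close>)
  ultimately show ?case ..
qed

text \<open>Pulling the uniform limit on \<open>U \<inter> S\<close> back along \<open>c\<close>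
  gives uniform convergence on small closed discs in \<open>D\<close>, where Weierstrass' theorem on
  limits of holomorphic functions applies.\<close>

lemma holomorphic_solution:
  "(\<lambda>z. fst (solution x (c z))) holomorphic_on D"
  "(\<lambda>z. snd (solution x (c z))) holomorphic_on D"
proof -
  have proj: "(\<lambda>z. \<pi> (solution x (c z))) holomorphic_on D"
    if \<pi>: "bounded_linear \<pi>" "\<And>n. (\<lambda>z. \<pi> (picard n x (c z))) holomorphic_on D" for \<pi> :: "complex \<times> complex \<Rightarrow> complex"
  proof (rule holomorphic_uniform_sequence[OF open_D])
    show "(\<lambda>z. \<pi> (\<Sum>i<n. picard i x (c z))) holomorphic_on D" for n
      unfolding linear_sum[OF bounded_linear.linear[OF \<pi>(1)]] by (intro holomorphic_intros \<pi>(2))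
    fix a assume a: "a \<in> D"
    obtain U where U: "open U" "c a \<in> U"
      "uniform_limit (U \<inter> S) (\<lambda>n p'. \<Sum>i<n. picard i x p') (solution x) sequentially"
      using uniform_limit_solution[OF c_in[OF a]] .
    obtain V where V: "open V" "a \<in> V" "\<And>z. z \<in> V \<Longrightarrow> z \<in> D \<Longrightarrow> c z \<in> U"
      using continuous_c a U(1,2) unfolding continuous_on_topological by metis
    obtain r where r: "r > 0" "cball a r \<subseteq> V \<inter> D"
      using V open_D a open_contains_cball[of "V \<inter> D"] by blast
    have "uniform_limit (cball a r) (\<lambda>n z. \<Sum>i<n. picard i x (c z)) (\<lambda>z. solution x (c z)) sequentially"
      by (rule uniform_limit_compose'[OF U(3)]) (use V r c_in in auto)
    then have "uniform_limit (cball a r) (\<lambda>n z. \<pi> (\<Sum>i<n. picard i x (c z))) (\<lambda>z. \<pi> (solution x (c z))) sequentially"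
      by (rule bounded_linear.uniform_limit[OF \<pi>(1)])
    then show "\<exists>d>0. cball a d \<subseteq> D \<and> uniform_limit (cball a d) (\<lambda>n z. \<pi> (\<Sum>i<n. picard i x (c z)))
        (\<lambda>z. \<pi> (solution x (c z))) sequentially"
      using r by auto
  qed
  show "(\<lambda>z. fst (solution x (c z))) holomorphic_on D"
    using holomorphic_picard by (intro proj bounded_linear_fst) auto
  show "(\<lambda>z. snd (solution x (c z))) holomorphic_on D"
    using holomorphic_picard by (intro proj bounded_linear_snd) auto
qed

end

section \<open>The Green functions\<close>

text \<open>Since \<open>\<mu> = 0\<close> is a removable singularity, the Green functions are regular in \<open>(k, \<lambda>)\<close>
  also at the branch points.\<close>

definition phase_quotient :: "real \<Rightarrow> complex \<Rightarrow> complex" where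
  "phase_quotient y \<mu> = (if \<mu> = 0 then 2 * \<i> * of_real y else (exp (2 * \<i> * \<mu> * of_real y) - 1) / \<mu>)"

lemma holomorphic_phase_quotient: "phase_quotient y holomorphic_on UNIV"
proof (rule no_isolated_singularity[where K = "{0}"])
  \<comment> \<open>The quotient is the difference quotient of this exponential at 0, so its limit
    is the derivative there, the value chosen in \<open>phase_quotient\<close>.\<close>
  have "((\<lambda>\<mu>. exp (2 * \<i> * \<mu> * of_real y)) has_field_derivative 2 * \<i> * of_real y) (at 0)"
    by (auto intro!: derivative_eq_intros)
  then have "((\<lambda>\<mu>. (exp (2 * \<i> * \<mu> * of_real y) - 1) / \<mu>) \<longlongrightarrow> phase_quotient y 0) (at 0)"
    by (simp add: has_field_derivative_iff phase_quotient_def)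
  moreover have "\<forall>\<^sub>F \<mu> in at 0. (exp (2 * \<i> * \<mu> * of_real y) - 1) / \<mu> = phase_quotient y \<mu>"
    by (auto simp: phase_quotient_def eventually_at_filter)
  ultimately have 0: "isCont (phase_quotient y) 0"
    unfolding isCont_def by (rule Lim_transform_eventually)
  show hol: "phase_quotient y holomorphic_on UNIV - {0}"
    by (rule holomorphic_transform[of "\<lambda>\<mu>. (exp (2 * \<i> * \<mu> * of_real y) - 1) / \<mu>"])
       (auto intro!: holomorphic_intros simp: phase_quotient_def)
  have "isCont (phase_quotient y) \<mu>" for \<mu>
    using 0 holomorphic_on_imp_continuous_on[OF hol]
    by (cases "\<mu> = 0") (auto simp: continuous_on_eq_continuous_at open_delete)
  then show "continuous_on UNIV (phase_quotient y)"
    by (simp add: continuous_at_imp_continuous_on)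
qed auto

lemma continuous_phase_quotient [continuous_intros]:
  "continuous_on A f \<Longrightarrow> continuous_on A (\<lambda>p. phase_quotient y (f p))"
  by (rule continuous_on_compose2[OF holomorphic_on_imp_continuous_on[OF holomorphic_phase_quotient]]) auto

lemma holomorphic_phase_quotient_compose [holomorphic_intros]:
  "f holomorphic_on A \<Longrightarrow> (\<lambda>p. phase_quotient y (f p)) holomorphic_on A"
  using holomorphic_on_compose_gen[OF _ holomorphic_phase_quotient, of f A y] by (simp add: o_def)

lemma measurable_phase_quotient [measurable]: "(\<lambda>y. phase_quotient y \<mu>) \<in> borel_measurable borel"
  unfolding phase_quotient_def
  by (cases "\<mu> = 0") (auto intro!: borel_measurable_continuous_onI continuous_intros)

section \<open>Bounds for the phases when the exponent lies in the closed upper half plane\<close>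

lemma norm_exp_upper_half_plane:
  assumes "0 \<le> Im \<mu>" "0 \<le> y"
  shows "norm (exp (2 * \<i> * \<mu> * of_real y)) \<le> 1"
  using assms by (simp add: norm_exp_eq_Re)

text \<open>Mean value inequality on the segment from 0 to z: it stays in the left half plane, where
  the derivative of exp has modulus at most 1.\<close>

lemma norm_exp_minus_1_le:
  fixes z :: complex
  assumes "Re z \<le> 0"
  shows "norm (exp z - 1) \<le> norm z"
proof -
  have "norm (exp z - exp 0) \<le> 1 * norm (z - 0)"
    by (rule field_differentiable_bound[of "{z. Re z \<le> 0}" exp exp])
       (use assms in \<open>auto intro!: DERIV_exp[THEN DERIV_subset] convex_halfspace_Re_le simp: norm_exp_eq_Re\<close>)
  then show ?thesis by simp
qed

lemma phase_quotient_le_inverse: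
  assumes "0 \<le> Im \<mu>" "0 \<le> y" "\<mu> \<noteq> 0"
  shows "norm (phase_quotient y \<mu>) \<le> 2 / norm \<mu>"
proof -
  have "norm (exp (2 * \<i> * \<mu> * of_real y) - 1) \<le> 2"
    using norm_triangle_ineq4[of "exp (2 * \<i> * \<mu> * of_real y)" 1] norm_exp_upper_half_plane[OF assms(1,2)]
    unfolding norm_one by linarith
  then show ?thesis
    using assms by (simp add: phase_quotient_def norm_divide divide_right_mono)
qed

lemma phase_quotient_le_linear:
  assumes "0 \<le> Im \<mu>" "0 \<le> y"
  shows "norm (phase_quotient y \<mu>) \<le> 2 * y"
proof (cases "\<mu> = 0")
  case False
  have "norm (exp (2 * \<i> * \<mu> * of_real y) - 1) \<le> norm (2 * \<i> * \<mu> * of_real y)"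
    using assms by (intro norm_exp_minus_1_le) simp
  also have "\<dots> = 2 * y * norm \<mu>"
    using assms by (simp add: norm_mult)
  finally show ?thesis
    using False by (simp add: phase_quotient_def norm_divide divide_le_eq)
qed (use assms in \<open>simp add: phase_quotient_def norm_mult\<close>)

text \<open>Let A have rows (-\<kappa>, m) and (n, \<kappa>). If A^2 = -\<mu>^2 I, this is exp(i
  \<mu> y) exp(y A) applied to v, the flow of v' = A v times a phase. The matrix A = ikJ + Q_- has
  square -\<lambda>^2 I because q_+ q_- = q_0^2.\<close>

definition propagate :: "complex \<Rightarrow> complex \<Rightarrow> complex \<Rightarrow> complex \<Rightarrow> real \<Rightarrow> cvec \<Rightarrow> cvec" where
  "propagate \<mu> \<kappa> m n y v =
    ((1 + exp (2 * \<i> * \<mu> * of_real y)) / 2 * fst v - \<i> / 2 * phase_quotient y \<mu> * (m * snd v - \<kappa> * fst v),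
     (1 + exp (2 * \<i> * \<mu> * of_real y)) / 2 * snd v - \<i> / 2 * phase_quotient y \<mu> * (n * fst v + \<kappa> * snd v))"

lemma norm_propagate_le:
  assumes "0 \<le> Im \<mu>" "0 \<le> y"
  shows "norm (propagate \<mu> \<kappa> m n y v)
    \<le> (1 + norm (phase_quotient y \<mu>) * (norm \<kappa> + norm m + norm n)) * (norm (fst v) + norm (snd v))"
proof -
  obtain a b where v: "v = (a, b)" by (cases v)
  define E where "E = (1 + exp (2 * \<i> * \<mu> * of_real y)) / 2"
  define \<phi> where "\<phi> = phase_quotient y \<mu>"
  have "norm (1 + exp (2 * \<i> * \<mu> * of_real y)) \<le> 2"
    using norm_triangle_ineq[of 1 "exp (2 * \<i> * \<mu> * of_real y)"] norm_exp_upper_half_plane[OF assms]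
    unfolding norm_one by linarith
  then have E: "norm E \<le> 1"
    by (simp add: E_def norm_divide)
  have comp: "norm (E * a - \<i> / 2 * \<phi> * c) \<le> norm a + norm \<phi> * norm c / 2" for a c
  proof -
    have "norm (E * a - \<i> / 2 * \<phi> * c) \<le> norm (E * a) + norm (\<i> / 2 * \<phi> * c)"
      by (rule norm_triangle_ineq4)
    also have "\<dots> \<le> norm a + norm \<phi> * norm c / 2"
      using mult_right_mono[OF E norm_ge_zero[of a]] by (simp add: norm_mult norm_divide)
    finally show ?thesis .
  qed
  \<comment> \<open>\<open>K\<close> dominates every coefficient, so either row of the matrix is at
    most K (|a| + |b|); the factors 1/2 in the two components then add up to one.\<close>
  define K where "K = norm \<kappa> + norm m + norm n"
  have "norm (m * b - \<kappa> * a) \<le> norm m * norm b + norm \<kappa> * norm a"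
    using norm_triangle_ineq4[of "m * b" "\<kappa> * a"] by (simp add: norm_mult)
  also have "\<dots> \<le> K * norm b + K * norm a"
    by (intro add_mono mult_right_mono) (auto simp: K_def)
  finally have c1: "norm (m * b - \<kappa> * a) \<le> K * (norm a + norm b)"
    by (simp add: algebra_simps)
  have "norm (n * a + \<kappa> * b) \<le> norm n * norm a + norm \<kappa> * norm b"
    using norm_triangle_ineq[of "n * a" "\<kappa> * b"] by (simp add: norm_mult)
  also have "\<dots> \<le> K * norm a + K * norm b"
    by (intro add_mono mult_right_mono) (auto simp: K_def)
  finally have c2: "norm (n * a + \<kappa> * b) \<le> K * (norm a + norm b)"
    by (simp add: algebra_simps)
  have "norm (propagate \<mu> \<kappa> m n y v)
      \<le> norm (E * a - \<i> / 2 * \<phi> * (m * b - \<kappa> * a)) + norm (E * b - \<i> / 2 * \<phi> * (n * a + \<kappa> * b))"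
    unfolding propagate_def v E_def \<phi>_def fst_conv snd_conv by (rule norm_Pair_le)
  also have "\<dots> \<le> (norm a + norm \<phi> * norm (m * b - \<kappa> * a) / 2) + (norm b + norm \<phi> * norm (n * a + \<kappa> * b) / 2)"
    by (intro add_mono comp)
  also have "\<dots> \<le> (norm a + norm \<phi> * (K * (norm a + norm b)) / 2) + (norm b + norm \<phi> * (K * (norm a + norm b)) / 2)"
    by (intro add_mono order_refl divide_right_mono mult_left_mono c1 c2) auto
  also have "\<dots> = (1 + norm \<phi> * K) * (norm a + norm b)"
    by (simp add: algebra_simps)
  finally show ?thesis by (simp add: \<phi>_def v K_def)
qed

text \<open>The common form of the four integrands. The eigenfunctions \<open>M\<close> and \<open>Mbar\<close> correspond to
  \<open>\<kappa> = \<i>\<close> with \<open>\<sigma> = 1\<close> and \<open>\<sigma> = - 1\<close>. The substitution \<open>x \<mapsto> - x\<close> turns the equations for \<open>N\<close>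
  and \<open>Nbar\<close> into the same form, with \<open>\<kappa> = - \<i>\<close> and \<open>Q\<^sub>+\<close> replaced by its negative.
  In all cases \<open>\<sigma> \<lambda>\<close> lies in the closed upper half plane.\<close>

definition jost_operator ::
  "complex \<Rightarrow> complex \<Rightarrow> complex \<Rightarrow> complex \<Rightarrow> (real \<Rightarrow> complex) \<Rightarrow> (real \<Rightarrow> complex) \<Rightarrow>
    complex \<times> complex \<Rightarrow> real \<Rightarrow> real \<Rightarrow> cvec \<Rightarrow> cvec" where
  "jost_operator \<sigma> \<kappa> m n \<alpha> \<beta> p x t v =
    (if t \<le> x then propagate (\<sigma> * snd p) (\<kappa> * fst p) m n (x - t) (\<alpha> t * snd v, \<beta> t * fst v) else 0)"

text \<open>The weight \<open>\<rho>\<close> decouples two questions: \<open>phase\<close> measures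
  the growth of the Green function in t, and \<open>int\<close> asks the potential to compensate
  exactly that growth.\<close>

lemma volterra_jost_operator:
  assumes meas: "\<alpha> \<in> borel_measurable borel" "\<beta> \<in> borel_measurable borel"
    and S: "\<And>p. p \<in> S \<Longrightarrow> 0 \<le> Im (\<sigma> * snd p)"
    and int: "\<And>x. set_integrable lborel {..x} (\<lambda>t. \<rho> t * (norm (\<alpha> t) + norm (\<beta> t)))"
    and \<rho>: "\<And>t. 1 \<le> \<rho> t"
    and phase: "\<And>p x. p \<in> S \<Longrightarrow> \<exists>U C. open U \<and> p \<in> U \<and> 0 \<le> C \<and>
      (\<forall>p'\<in>U \<inter> S. \<forall>t\<le>x. \<forall>y\<in>{0..x - t}. norm (phase_quotient y (\<sigma> * snd p')) \<le> C * \<rho> t)"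
    and F0: "continuous_on S F0"
  shows "volterra S (jost_operator \<sigma> \<kappa> m n \<alpha> \<beta>) F0"
proof (rule volterra.intro)
  fix p :: "complex \<times> complex" and x t :: real and v :: cvec
  show "jost_operator \<sigma> \<kappa> m n \<alpha> \<beta> p x t v = 0" if "x < t"
    using that by (simp add: jost_operator_def)
next
  fix p :: "complex \<times> complex" and x t :: real assume p: "p \<in> S"
  show "bounded_linear (jost_operator \<sigma> \<kappa> m n \<alpha> \<beta> p x t)"
    by (intro linear_conv_bounded_linear[THEN iffD1] linearI) (auto simp: jost_operator_def propagate_def algebra_simps add_divide_distrib scaleR_conv_of_real)
next
  fix p :: "complex \<times> complex" and h :: "real \<Rightarrow> cvec"
  assume p: "p \<in> S" and h: "h \<in> borel_measurable borel"
  have fst_snd [measurable]: "fst \<in> borel_measurable (borel :: cvec measure)" "snd \<in> borel_measurable (borel :: cvec measure)"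
    by (auto intro!: borel_measurable_continuous_onI continuous_intros)
  note [measurable] = meas h
  have [measurable]: "(\<lambda>u. fst (h (snd u))) \<in> borel_measurable (borel \<Otimes>\<^sub>M borel)"
    "(\<lambda>u. snd (h (snd u))) \<in> borel_measurable (borel \<Otimes>\<^sub>M borel)"
    by measurable
  show "(\<lambda>(x, t). jost_operator \<sigma> \<kappa> m n \<alpha> \<beta> p x t (h t)) \<in> borel_measurable (borel \<Otimes>\<^sub>M borel)"
    unfolding jost_operator_def propagate_def split_beta fst_conv snd_conv
    by (intro measurable_If borel_measurable_Pair) measurable
next
  fix g :: "complex \<times> complex \<Rightarrow> cvec" and x t :: real assume g: "continuous_on S g"
  show "continuous_on S (\<lambda>p. jost_operator \<sigma> \<kappa> m n \<alpha> \<beta> p x t (g p))"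
    unfolding jost_operator_def propagate_def
    by (cases "t \<le> x") (auto intro!: continuous_intros g)
next
  fix p :: "complex \<times> complex" and x0 :: real assume p: "p \<in> S"
  obtain U C where U: "open U" "p \<in> U" "0 \<le> C"
    "\<And>p' t y. p' \<in> U \<Longrightarrow> p' \<in> S \<Longrightarrow> t \<le> x0 \<Longrightarrow> 0 \<le> y \<Longrightarrow> y \<le> x0 - t \<Longrightarrow>
      norm (phase_quotient y (\<sigma> * snd p')) \<le> C * \<rho> t"
    using phase[OF p, of x0] by (elim exE conjE) auto
  \<comment> \<open>On \<open>ball p 1\<close> the spectral parameter satisfies |k| \<le> |p| + 1,
    so \<open>K\<close> is uniform there.\<close>
  define K where "K = norm \<kappa> * (norm p + 1) + norm m + norm n"
  have K: "K \<ge> 0" by (simp add: K_def)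
  define w where "w t = (1 + C * K) * (indicator {..x0} t * (\<rho> t * (norm (\<alpha> t) + norm (\<beta> t))))" for t
  have \<rho>0: "\<rho> t \<ge> 0" for t using \<rho>[of t] by simp
  show "\<exists>U w. open U \<and> p \<in> U \<and> integrable lborel w \<and> (\<forall>t. 0 \<le> w t) \<and>
      (\<forall>p'\<in>U \<inter> S. \<forall>x\<le>x0. \<forall>t\<le>x. \<forall>v. norm (jost_operator \<sigma> \<kappa> m n \<alpha> \<beta> p' x t v) \<le> w t * norm v)"
  proof (intro exI[of _ "U \<inter> ball p 1"] exI[of _ w] conjI ballI allI impI)
    show "integrable lborel w"
      using int[of x0] unfolding w_def set_integrable_def by simp
    show "0 \<le> w t" for t
      unfolding w_def using U(3) K \<rho>0[of t] by (intro mult_nonneg_nonneg add_nonneg_nonneg) auto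
    fix p' x t v assume p': "p' \<in> U \<inter> ball p 1 \<inter> S" and x: "x \<le> x0" and t: "t \<le> x"
    have "norm (fst p') \<le> norm p + 1"
      using p' norm_fst_le[of "fst p'" "snd p'"] norm_triangle_ineq2[of p' p] by (auto simp: dist_norm norm_minus_commute)
    then have k: "norm (\<kappa> * fst p') + norm m + norm n \<le> K"
      unfolding K_def by (simp add: norm_mult mult_left_mono)
    have "norm (phase_quotient (x - t) (\<sigma> * snd p')) * (norm (\<kappa> * fst p') + norm m + norm n) \<le> C * \<rho> t * K"
      using U(3) \<rho>0 U(4)[of p' t "x - t"] p' x t k by (intro mult_mono) auto
    \<comment> \<open>Here \<open>1 \<le> \<rho> t\<close> absorbs the summand 1, giving the
      constant built into \<open>w\<close>.\<close>
    then have "1 + norm (phase_quotient (x - t) (\<sigma> * snd p')) * (norm (\<kappa> * fst p') + norm m + norm n)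
        \<le> (1 + C * K) * \<rho> t"
      using \<rho>[of t] by (simp add: algebra_simps)
    moreover have "norm (\<alpha> t * snd v) + norm (\<beta> t * fst v) \<le> (norm (\<alpha> t) + norm (\<beta> t)) * norm v"
      using mult_left_mono[OF norm_snd_le[of "snd v" "fst v"] norm_ge_zero[of "\<alpha> t"]]
        mult_left_mono[OF norm_fst_le[of "fst v" "snd v"] norm_ge_zero[of "\<beta> t"]]
      by (simp add: norm_mult algebra_simps)
    ultimately have "(1 + norm (phase_quotient (x - t) (\<sigma> * snd p')) * (norm (\<kappa> * fst p') + norm m + norm n))
          * (norm (\<alpha> t * snd v) + norm (\<beta> t * fst v))
        \<le> ((1 + C * K) * \<rho> t) * ((norm (\<alpha> t) + norm (\<beta> t)) * norm v)"
      using U(3) K \<rho>0 by (intro mult_mono) auto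
    moreover have "norm (jost_operator \<sigma> \<kappa> m n \<alpha> \<beta> p' x t v)
        \<le> (1 + norm (phase_quotient (x - t) (\<sigma> * snd p')) * (norm (\<kappa> * fst p') + norm m + norm n))
          * (norm (\<alpha> t * snd v) + norm (\<beta> t * fst v))"
      using norm_propagate_le[of "\<sigma> * snd p'" "x - t" "\<kappa> * fst p'" m n "(\<alpha> t * snd v, \<beta> t * fst v)"] S[of p'] p' t
      by (simp add: jost_operator_def)
    ultimately show "norm (jost_operator \<sigma> \<kappa> m n \<alpha> \<beta> p' x t v) \<le> w t * norm v"
      using t x by (simp add: w_def mult.assoc)
  qed (use U in auto)
qed (rule F0)

section \<open>The two sheets\<close>

lemma sheet_domain_not_nonpos:
  assumes "k \<in> sheet_domain q0"
  shows "of_real q0 - k \<notin> \<real>\<^sub>\<le>\<^sub>0" "of_real q0 + k \<notin> \<real>\<^sub>\<le>\<^sub>0"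
  using assms by (auto simp: sheet_domain_def branch_cut_def complex_nonpos_Reals_iff)

text \<open>The half angle lies strictly between -\<pi>/2 and \<pi>/2, so this root has positive
  real part and is the principal one.\<close>

lemma csqrt_polar:
  assumes "0 < r" "- pi < \<theta>" "\<theta> < pi"
  shows "csqrt (of_real r * exp (\<i> * of_real \<theta>)) = of_real (sqrt r) * exp (\<i> * of_real (\<theta> / 2))"
proof (rule csqrt_unique)
  have "(of_real (sqrt r) :: complex)\<^sup>2 = of_real r"
    using assms(1) by (simp flip: of_real_power)
  then show "(of_real (sqrt r) * exp (\<i> * of_real (\<theta> / 2)))\<^sup>2 = of_real r * exp (\<i> * of_real \<theta>)"
    by (simp add: power_mult_distrib flip: exp_double)
  have "0 < cos (\<theta> / 2)"
    using assms by (intro cos_gt_zero_pi) auto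
  then show "0 < Re (of_real (sqrt r) * exp (\<i> * of_real (\<theta> / 2)))
    \<or> Re (of_real (sqrt r) * exp (\<i> * of_real (\<theta> / 2))) = 0 \<and> 0 \<le> Im (of_real (sqrt r) * exp (\<i> * of_real (\<theta> / 2)))"
    using assms by (simp add: Re_exp)
qed

text \<open>In this form the only discontinuities are the cuts of the two principal roots, k \<ge>
  q_0 and k \<le> -q_0; holomorphy and the sign of the imaginary part become visible.\<close>

lemma lambda1_eq:
  assumes "k \<in> sheet_domain q0"
  shows "lambda1 q0 k = \<i> * csqrt (of_real q0 - k) * csqrt (of_real q0 + k)"
proof -
  define u v where "u = k - of_real q0" and "v = k + of_real q0"
  define a b where "a = arg_0_2pi u" and "b = arg_mpi_pi v"
  note nonpos = sheet_domain_not_nonpos[OF assms]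
  have u: "u \<noteq> 0" "- u \<notin> \<real>\<^sub>\<le>\<^sub>0" and v: "v \<noteq> 0" "v \<notin> \<real>\<^sub>\<le>\<^sub>0"
    using nonpos by (auto simp: u_def v_def add.commute)
  have "Arg u \<noteq> 0"
    using u by (auto simp: Arg_eq_0 complex_nonpos_Reals_iff complex_is_Real_iff)
  then have a: "0 < a" "a < 2 * pi"
    using mpi_less_Arg[of u] Arg_le_pi[of u] pi_gt_zero by (auto simp: a_def arg_0_2pi_def)
  have "Arg v \<noteq> pi"
    using v by (auto simp: Arg_eq_pi complex_nonpos_Reals_iff)
  then have b: "- pi < b" "b < pi" "b = Arg v"
    using mpi_less_Arg[of v] Arg_le_pi[of v] by (auto simp: b_def arg_mpi_pi_def)
  have ua: "u = of_real (norm u) * exp (\<i> * of_real a)"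
    using Arg_eq[OF u(1)] by (auto simp: a_def arg_0_2pi_def ring_distribs exp_add mult.commute mult.left_commute)
  \<comment> \<open>Since \<open>a\<close> lies in (0, 2\<pi>), \<open>a - pi\<close> is the
    principal argument of \<open>- u\<close>. Halving the shift costs the factor exp(-i\<pi>/2) =
    -i, which the leading \<open>\<i>\<close> cancels.\<close>
  have "- u = of_real (norm u) * exp (\<i> * of_real (a - pi))"
    by (subst ua) (simp add: ring_distribs exp_diff)
  then have "csqrt (- u) = of_real (sqrt (norm u)) * exp (\<i> * of_real ((a - pi) / 2))"
    using csqrt_polar[of "norm u" "a - pi"] u(1) a by simp
  also have "exp (\<i> * of_real ((a - pi) / 2)) = exp (\<i> * of_real (a / 2)) * (- \<i>)"
    unfolding cis_conv_exp[symmetric]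
    by (simp add: complex_eq_iff diff_divide_distrib cos_diff sin_diff)
  finally have su: "csqrt (- u) = of_real (sqrt (norm u)) * (exp (\<i> * of_real (a / 2)) * (- \<i>))" .
  have sv: "csqrt v = of_real (sqrt (norm v)) * exp (\<i> * of_real (b / 2))"
    using csqrt_polar[of "norm v" b] v(1) b Arg_eq[OF v(1)] by simp
  have "lambda1 q0 k = of_real (sqrt (norm u) * sqrt (norm v)) * exp (\<i> * of_real ((a + b) / 2))"
    by (simp add: lambda1_def u_def v_def a_def b_def real_sqrt_mult)
  also have "exp (\<i> * of_real ((a + b) / 2)) = exp (\<i> * of_real (a / 2)) * exp (\<i> * of_real (b / 2))"
    by (simp add: add_divide_distrib distrib_left exp_add)
  also have "of_real (sqrt (norm u) * sqrt (norm v)) * (exp (\<i> * of_real (a / 2)) * exp (\<i> * of_real (b / 2)))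
      = \<i> * csqrt (- u) * csqrt v"
    unfolding su sv by (simp add: algebra_simps)
  finally show ?thesis
    by (simp add: u_def v_def add.commute)
qed

lemma open_sheet_domain: "open (sheet_domain q0)"
proof -
  have "closed {k. Im k = 0 \<and> q0 \<le> \<bar>Re k\<bar>}"
    by (intro closed_Collect_conj closed_Collect_eq closed_Collect_le continuous_intros)
  then show ?thesis unfolding sheet_domain_def branch_cut_def by (simp add: open_Diff)
qed

lemma holomorphic_lambda1: "lambda1 q0 holomorphic_on sheet_domain q0"
proof (rule holomorphic_transform)
  show "(\<lambda>k. \<i> * csqrt (of_real q0 - k) * csqrt (of_real q0 + k)) holomorphic_on sheet_domain q0"
    by (intro holomorphic_intros) (simp_all add: sheet_domain_not_nonpos)
qed (simp add: lambda1_eq)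

lemma lambda1_square:
  assumes "k \<in> sheet_domain q0"
  shows "(lambda1 q0 k)\<^sup>2 = k\<^sup>2 - of_real q0 ^ 2"
proof -
  have "(lambda1 q0 k)\<^sup>2 = - ((csqrt (of_real q0 - k))\<^sup>2 * (csqrt (of_real q0 + k))\<^sup>2)"
    by (simp add: lambda1_eq[OF assms] power_mult_distrib del: power2_csqrt)
  also have "\<dots> = k\<^sup>2 - of_real q0 ^ 2"
    unfolding power2_csqrt by (simp add: power2_eq_square algebra_simps)
  finally show ?thesis .
qed

text \<open>Im(iAB) = Re A Re B - Im A Im B. Principal roots have nonnegative real part, and q_0 - k
  and q_0 + k have opposite imaginary parts, so Im A Im B \<le> 0. The nonstrict inequality is what
  survives closure.\<close>

lemma Im_lambda1_nonneg:
  assumes "k \<in> sheet_domain q0" "q0 > 0"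
  shows "0 \<le> Im (lambda1 q0 k)"
proof -
  define A B where "A = csqrt (of_real q0 - k)" and "B = csqrt (of_real q0 + k)"
  have im: "Im A * Im B \<le> 0"
  \<comment> \<open>The sign formula for the imaginary part of \<open>csqrt\<close> holds off the
    real axis only. A real k off the cut has |k| < q_0, so \<open>A\<close> is the root of a
    positive number.\<close>
  proof (cases "Im k = 0")
    case True
    then have "Im A = 0"
      using assms by (simp add: A_def sheet_domain_def branch_cut_def cmod_eq_Re)
    then show ?thesis by simp
  next
    case False
    then have "Im A * Im B = sgn (- Im k) * sgn (Im k)
        * (sqrt ((norm (of_real q0 - k) - Re (of_real q0 - k)) / 2) * sqrt ((norm (of_real q0 + k) - Re (of_real q0 + k)) / 2))"
      by (simp add: A_def B_def)
    also have "\<dots> \<le> 0"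
    proof (rule mult_nonpos_nonneg)
      show "sgn (- Im k) * sgn (Im k) \<le> 0" by (simp add: sgn_if)
    qed (use complex_Re_le_cmod[of "of_real q0 - k"] complex_Re_le_cmod[of "of_real q0 + k"] in simp)
    finally show ?thesis .
  qed
  have "0 \<le> Re A" "0 \<le> Re B"
    unfolding A_def B_def using csqrt_principal by (metis less_eq_real_def)+
  then have "0 \<le> Re A * Re B" by simp
  with im show ?thesis
    by (simp add: lambda1_eq[OF assms(1)] A_def[symmetric] B_def[symmetric])
qed

section \<open>Closed sheets as subsets of the curve \<lambda>^2 = k^2 - q_0^2\<close>

definition sheet :: "complex \<Rightarrow> real \<Rightarrow> (complex \<times> complex) set" where
  "sheet \<sigma> q0 = closure ((\<lambda>k. (k, \<sigma> * lambda1 q0 k)) ` sheet_domain q0)"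

text \<open>Both are closed conditions on (k, \<lambda>) that hold on the graph over the cut plane,
  so they persist on its closure, in particular on both edges of the cut.\<close>

lemma sheet_properties:
  assumes "q0 > 0" "\<sigma> * \<sigma> = 1" "p \<in> sheet \<sigma> q0"
  shows "0 \<le> Im (\<sigma> * snd p)" "(snd p)\<^sup>2 = (fst p)\<^sup>2 - of_real q0 ^ 2"
proof -
  have inv: "\<sigma> * (\<sigma> * z) = z" for z
    by (simp only: mult.assoc[symmetric] assms(2) mult_1)
  have "closed {p. 0 \<le> Im (\<sigma> * snd p) \<and> (snd p)\<^sup>2 = (fst p)\<^sup>2 - of_real q0 ^ 2}"
    by (intro closed_Collect_conj closed_Collect_eq closed_Collect_le continuous_intros)
  moreover have "(\<lambda>k. (k, \<sigma> * lambda1 q0 k)) ` sheet_domain q0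
      \<subseteq> {p. 0 \<le> Im (\<sigma> * snd p) \<and> (snd p)\<^sup>2 = (fst p)\<^sup>2 - of_real q0 ^ 2}"
    by (auto simp only: fst_conv snd_conv mem_Collect_eq inv power_mult_distrib power2_eq_square[of \<sigma>]
        assms(2) mult_1 lambda1_square intro!: Im_lambda1_nonneg assms(1))
  ultimately have "sheet \<sigma> q0 \<subseteq> {p. 0 \<le> Im (\<sigma> * snd p) \<and> (snd p)\<^sup>2 = (fst p)\<^sup>2 - of_real q0 ^ 2}"
    unfolding sheet_def by (intro closure_minimal)
  with assms show "0 \<le> Im (\<sigma> * snd p)" "(snd p)\<^sup>2 = (fst p)\<^sup>2 - of_real q0 ^ 2"
    by auto
qed

lemma graph_in_sheet:
  assumes "q0 > 0" "k \<in> sheet_domain q0"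
  shows "(k, \<sigma> * lambda1 q0 k) \<in> sheet \<sigma> q0 - branch_points q0"
proof
  show "(k, \<sigma> * lambda1 q0 k) \<in> sheet \<sigma> q0"
    unfolding sheet_def using assms(2) by (intro subsetD[OF closure_subset] imageI)
  show "(k, \<sigma> * lambda1 q0 k) \<notin> branch_points q0"
    using assms by (auto simp: branch_points_def sheet_domain_def branch_cut_def)
qed

section \<open>The eigenfunctions\<close>

text \<open>By the equation of the curve, \<lambda> vanishes only over k = q_0 and k = -q_0, so
  |\<lambda>| is bounded below near \<open>p\<close>.\<close>

lemma phase_quotient_bound_away_from_branch_points:
  assumes q0: "q0 > 0" and \<sigma>: "\<sigma> * \<sigma> = 1" and p: "p \<in> sheet \<sigma> q0 - branch_points q0"
  shows "\<exists>U C. open U \<and> p \<in> U \<and> 0 \<le> C \<and> (\<forall>p'\<in>U \<inter> (sheet \<sigma> q0 - branch_points q0).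
    \<forall>t\<le>x. \<forall>y\<in>{0..x - t}. norm (phase_quotient y (\<sigma> * snd p')) \<le> C * 1)"
proof -
  have "snd p \<noteq> 0"
  proof
    assume "snd p = 0"
    then have "(fst p)\<^sup>2 = of_real q0 ^ 2"
      using sheet_properties(2)[OF q0 \<sigma>, of p] p by simp
    then show False
      using p by (auto simp: power2_eq_iff branch_points_def)
  qed
  have "norm \<sigma> * norm \<sigma> = 1"
    using \<sigma> by (metis norm_mult norm_one)
  then have n\<sigma>: "norm \<sigma> = 1"
    by (metis abs_norm_cancel abs_square_eq_1 power2_eq_square)
  show ?thesis
  \<comment> \<open>On this neighbourhood |\<lambda>| exceeds half its value at \<open>p\<close>,
    which turns 2/|\<lambda>| into the constant 4 / \<open>norm (snd p)\<close>.\<close>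
  proof (intro exI[of _ "{p'. norm (snd p) / 2 < norm (snd p')}"] exI[of _ "4 / norm (snd p)"] conjI ballI allI impI)
    show "open {p' :: complex \<times> complex. norm (snd p) / 2 < norm (snd p')}"
      by (intro open_Collect_less continuous_intros)
    fix p' and t y :: real
    assume p': "p' \<in> {p'. norm (snd p) / 2 < norm (snd p')} \<inter> (sheet \<sigma> q0 - branch_points q0)"
      and y: "y \<in> {0..x - t}"
    have gt: "norm (snd p') > norm (snd p) / 2" "norm (snd p) > 0"
      using p' \<open>snd p \<noteq> 0\<close> by auto
    have "norm (phase_quotient y (\<sigma> * snd p')) \<le> 2 / norm (\<sigma> * snd p')"
      using p' y gt n\<sigma> sheet_properties(1)[OF q0 \<sigma>, of p']
      by (intro phase_quotient_le_inverse) auto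
    also have "\<dots> \<le> 4 / norm (snd p)"
    proof -
      have "norm (snd p') > 0" using gt by linarith
      then have "2 / norm (snd p') \<le> 2 / (norm (snd p) / 2)"
        using gt by (intro divide_left_mono mult_pos_pos) auto
      then show ?thesis using n\<sigma> by (simp add: norm_mult)
    qed
    finally show "norm (phase_quotient y (\<sigma> * snd p')) \<le> 4 / norm (snd p) * 1" by simp
  qed (use \<open>snd p \<noteq> 0\<close> in auto)
qed

text \<open>From y \<le> |x| + |t| \<le> (1 + |x|)(1 + |t|). The constant depends on x alone, so no
  shrinking of the neighbourhood is called for, even at \<lambda> = 0.\<close>

lemma phase_quotient_bound_on_sheet:
  assumes q0: "q0 > 0" and \<sigma>: "\<sigma> * \<sigma> = 1"
  shows "\<exists>U C. open U \<and> p \<in> U \<and> 0 \<le> C \<and> (\<forall>p'\<in>U \<inter> sheet \<sigma> q0.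
    \<forall>t\<le>x. \<forall>y\<in>{0..x - t}. norm (phase_quotient y (\<sigma> * snd p')) \<le> C * (1 + \<bar>t\<bar>))"
proof (intro exI[of _ UNIV] exI[of _ "2 * (1 + \<bar>x\<bar>)"] conjI ballI allI impI)
  fix p' and t y :: real
  assume p': "p' \<in> UNIV \<inter> sheet \<sigma> q0" and y: "y \<in> {0..x - t}"
  have "norm (phase_quotient y (\<sigma> * snd p')) \<le> 2 * y"
    using p' y sheet_properties(1)[OF q0 \<sigma>, of p'] by (intro phase_quotient_le_linear) auto
  also have "\<dots> \<le> 2 * (\<bar>x\<bar> + \<bar>t\<bar>)" using y by auto
  also have "\<dots> \<le> 2 * (1 + \<bar>x\<bar>) * (1 + \<bar>t\<bar>)"
    by (simp add: algebra_simps)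
  finally show "norm (phase_quotient y (\<sigma> * snd p')) \<le> 2 * (1 + \<bar>x\<bar>) * (1 + \<bar>t\<bar>)" .
qed auto

text \<open>The weight \<open>\<rho>\<close> is the growth in \<open>t\<close> of the Green functions at \<open>x - t\<close>: bounded as long as
  \<open>\<lambda>\<close> stays away from 0, linear in general.\<close>

definition admissible :: "complex \<Rightarrow> real \<Rightarrow> (complex \<times> complex) set \<Rightarrow> (real \<Rightarrow> real) \<Rightarrow> bool" where
  "admissible \<sigma> q0 S \<rho> \<longleftrightarrow>
    S = sheet \<sigma> q0 - branch_points q0 \<and> \<rho> = (\<lambda>_. 1) \<or> S = sheet \<sigma> q0 \<and> \<rho> = (\<lambda>t. 1 + \<bar>t\<bar>)"

text \<open>The coefficients and \<open>F0\<close> stay free, so that all four eigenfunctions, with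
  or without the branch points, are instances.\<close>

lemma jost_operator_solution:
  assumes q0: "q0 > 0" and \<sigma>: "\<sigma> * \<sigma> = 1" and S: "admissible \<sigma> q0 S \<rho>"
    and meas: "\<alpha> \<in> borel_measurable borel" "\<beta> \<in> borel_measurable borel"
    and int: "\<And>x. set_integrable lborel {..x} (\<lambda>t. \<rho> t * (norm (\<alpha> t) + norm (\<beta> t)))"
    and F0: "continuous_on UNIV F0"
    and hol_F0: "(\<lambda>k. fst (F0 (k, \<sigma> * lambda1 q0 k))) holomorphic_on sheet_domain q0"
      "(\<lambda>k. snd (F0 (k, \<sigma> * lambda1 q0 k))) holomorphic_on sheet_domain q0"
  obtains F where
    "\<And>p x. p \<in> S \<Longrightarrow> integrable lborel (\<lambda>t. jost_operator \<sigma> \<kappa> m n \<alpha> \<beta> p x t (F t p))"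
    "\<And>p x. p \<in> S \<Longrightarrow> F x p = F0 p + (\<integral>t. jost_operator \<sigma> \<kappa> m n \<alpha> \<beta> p x t (F t p) \<partial>lborel)"
    "regular_on q0 (\<lambda>k. \<sigma> * lambda1 q0 k) S F"
proof -
  let ?T = "jost_operator \<sigma> \<kappa> m n \<alpha> \<beta>"
  have "volterra S ?T F0"
  proof (rule volterra_jost_operator[OF meas _ int])
    show "\<exists>U C. open U \<and> p \<in> U \<and> 0 \<le> C \<and>
      (\<forall>p'\<in>U \<inter> S. \<forall>t\<le>x. \<forall>y\<in>{0..x - t}. norm (phase_quotient y (\<sigma> * snd p')) \<le> C * \<rho> t)"
      if "p \<in> S" for p x
      using S phase_quotient_bound_away_from_branch_points[OF q0 \<sigma>, of p x]
        phase_quotient_bound_on_sheet[OF q0 \<sigma>, of p x] that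
      unfolding admissible_def by (elim disjE conjE) simp_all
    show "0 \<le> Im (\<sigma> * snd p)" if "p \<in> S" for p
      using S that sheet_properties(1)[OF q0 \<sigma>, of p] unfolding admissible_def by blast
    show "1 \<le> \<rho> t" for t
      using S by (auto simp: admissible_def)
    show "continuous_on S F0"
      using F0 continuous_on_subset by blast
  qed
  then interpret volterra S ?T F0 .
  have graph: "(k, \<sigma> * lambda1 q0 k) \<in> S" if "k \<in> sheet_domain q0" for k
    using S graph_in_sheet[OF q0 that, of \<sigma>] by (auto simp: admissible_def)
  interpret holomorphic_volterra S ?T F0 "sheet_domain q0" "\<lambda>k. (k, \<sigma> * lambda1 q0 k)"
  proof
    show "continuous_on (sheet_domain q0) (\<lambda>k. (k, \<sigma> * lambda1 q0 k))"
      by (intro continuous_intros holomorphic_on_imp_continuous_on holomorphic_lambda1)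
    fix h :: "complex \<Rightarrow> cvec" and x t
    assume "(\<lambda>z. fst (h z)) holomorphic_on sheet_domain q0" "(\<lambda>z. snd (h z)) holomorphic_on sheet_domain q0"
    then show "(\<lambda>z. fst (?T (z, \<sigma> * lambda1 q0 z) x t (h z))) holomorphic_on sheet_domain q0 \<and>
        (\<lambda>z. snd (?T (z, \<sigma> * lambda1 q0 z) x t (h z))) holomorphic_on sheet_domain q0"
      unfolding jost_operator_def propagate_def
      by (cases "t \<le> x") (auto intro!: holomorphic_intros holomorphic_lambda1)
  qed (use hol_F0 graph open_sheet_domain in auto)
  show ?thesis
  proof (rule that[OF solution_solves])
    show "regular_on q0 (\<lambda>k. \<sigma> * lambda1 q0 k) S solution"
      unfolding regular_on_def by (intro allI conjI continuous_solution holomorphic_solution)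
  qed
qed

text \<open>The hypotheses compare q with its left limit on the left half line only. To reach x > 0,
  the missing piece is compact: there \<open>\<rho>\<close> is bounded, and f - l differs from the
  integrable f - l' by a constant.\<close>

lemma set_integrable_weighted_difference:
  fixes f :: "real \<Rightarrow> complex"
  assumes meas: "f \<in> borel_measurable borel" and \<rho>: "continuous_on UNIV \<rho>"
    and left: "set_integrable lborel {..0} (\<lambda>t. \<rho> t * norm (f t - l))"
    and right: "set_integrable lborel {0..} (\<lambda>t. f t - l')"
  shows "set_integrable lborel {..x} (\<lambda>t. \<rho> t * norm (f t - l))"
proof -
  \<comment> \<open>With this \<open>b\<close>, the union of \<open>{..0}\<close> and
    \<open>{0..b}\<close> covers \<open>{..x}\<close> for either sign of x.\<close>
  define b where "b = max x 0"
  obtain B where B: "\<And>t. t \<in> {0..b} \<Longrightarrow> norm (\<rho> t) \<le> B"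
    using compact_imp_bounded[OF compact_continuous_image[OF continuous_on_subset[OF \<rho>], of "{0..b}"]]
    unfolding bounded_iff by blast
  have [measurable]: "\<rho> \<in> borel_measurable borel"
    using \<rho> by (rule borel_measurable_continuous_onI)
  note [measurable] = meas
  have "set_integrable lborel {0..b} (\<lambda>t. \<rho> t * norm (f t - l))"
    unfolding set_integrable_def
  proof (rule Bochner_Integration.integrable_bound)
    have "integrable lborel (\<lambda>t. norm (indicator {0..} t *\<^sub>R (f t - l')))"
      using right unfolding set_integrable_def by (rule integrable_norm)
    moreover have "integrable lborel (\<lambda>t. indicator {0..b} t * norm (l' - l))"
      by (intro integrable_mult_left integrable_real_indicator) (auto simp: emeasure_lborel_Icc_eq)
    ultimately show "integrable lborel (\<lambda>t. B * (norm (indicator {0..} t *\<^sub>R (f t - l')) + indicator {0..b} t * norm (l' - l)))"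
      by simp
    show "(\<lambda>t. indicator {0..b} t *\<^sub>R (\<rho> t * norm (f t - l))) \<in> borel_measurable lborel"
      by measurable
    show "AE t in lborel. norm (indicator {0..b} t *\<^sub>R (\<rho> t * norm (f t - l)))
        \<le> norm (B * (norm (indicator {0..} t *\<^sub>R (f t - l')) + indicator {0..b} t * norm (l' - l)))"
    proof (rule AE_I2)
      fix t
      show "norm (indicator {0..b} t *\<^sub>R (\<rho> t * norm (f t - l)))
        \<le> norm (B * (norm (indicator {0..} t *\<^sub>R (f t - l')) + indicator {0..b} t * norm (l' - l)))"
      proof (cases "t \<in> {0..b}")
        case True
        have "norm (f t - l) \<le> norm (f t - l') + norm (l' - l)"
          using norm_triangle_ineq[of "f t - l'" "l' - l"] by simp
        then have "norm (\<rho> t) * norm (f t - l) \<le> B * (norm (f t - l') + norm (l' - l))"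
          using B[OF True] by (intro mult_mono) (auto intro: order_trans[OF norm_ge_zero])
        also have "\<dots> \<le> norm (B * (norm (f t - l') + norm (l' - l)))" by simp
        finally show ?thesis using True by (simp add: abs_mult)
      qed simp
    qed
  qed
  then have "set_integrable lborel ({..0} \<union> {0..b}) (\<lambda>t. \<rho> t * norm (f t - l))"
    using left by (intro set_integrable_Un) auto
  then show ?thesis
    by (rule set_integrable_subset) (auto simp: b_def)
qed

lemma set_integrable_reflect:
  fixes f :: "real \<Rightarrow> 'a::{banach, second_countable_topology}"
  shows "set_integrable lborel (uminus ` A) (\<lambda>t. f (- t)) \<longleftrightarrow> set_integrable lborel A f"
proof -
  have "indicator (uminus ` A) (- t) = (indicator A t :: real)" for t
    by (auto simp: indicator_def)
  then show ?thesis
    unfolding set_integrable_def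
    using lborel_integrable_real_affine_iff[of "-1" "\<lambda>t. indicator (uminus ` A) t *\<^sub>R f (- t)" 0] by simp
qed

section \<open>Reduction of the four integral equations to the common operator\<close>

lemma Gm_eq_jost_operator:
  "mvec (mmul (Gm qp qm (snd p) (x - t) (fst p)) (msub (Qmat q t) (QinfM qm qp))) v
    = jost_operator 1 \<i> qm qp (\<lambda>t. q t - qm) (\<lambda>t. q (- t) - qp) p x t v"
  by (cases v) (auto simp: mvec_def mmul_def Gm_def msub_def Qmat_def QinfM_def madd_def mscale_def mId_def ikJplus_def
    Jmat_def heaviside_def jost_operator_def propagate_def phase_quotient_def zero_prod_def field_simps)

lemma Gmbar_eq_jost_operator:
  "mvec (mmul (Gmbar qp qm (snd p) (x - t) (fst p)) (msub (Qmat q t) (QinfM qm qp))) v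
    = jost_operator (- 1) \<i> qm qp (\<lambda>t. q t - qm) (\<lambda>t. q (- t) - qp) p x t v"
  by (cases v) (auto simp: mvec_def mmul_def Gmbar_def msub_def Qmat_def QinfM_def madd_def mscale_def mId_def ikJplus_def
    Jmat_def heaviside_def jost_operator_def propagate_def phase_quotient_def zero_prod_def field_simps)

text \<open>The minus sign in front of \<open>Gp\<close> moves into the potential, whence qp - q(-t)
  and qm - q(t). The value 1 of \<open>heaviside\<close> at 0 matches the closed condition t \<le>
  x.\<close>

lemma Gp_eq_jost_operator:
  "mvec (mmul (Gp qp qm (snd p) (- x + t) (fst p)) (msub (Qmat q (- t)) (QinfM qp qm))) v
    = jost_operator 1 (- \<i>) (- qp) (- qm) (\<lambda>t. qp - q (- t)) (\<lambda>t. qm - q t) p x t v"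
  by (cases v) (auto simp: mvec_def mmul_def Gp_def msub_def Qmat_def QinfM_def madd_def mscale_def mId_def ikJplus_def
    Jmat_def heaviside_def jost_operator_def propagate_def phase_quotient_def zero_prod_def field_simps)

lemma Gpbar_eq_jost_operator:
  "mvec (mmul (Gpbar qp qm (snd p) (- x + t) (fst p)) (msub (Qmat q (- t)) (QinfM qp qm))) v
    = jost_operator (- 1) (- \<i>) (- qp) (- qm) (\<lambda>t. qp - q (- t)) (\<lambda>t. qm - q t) p x t v"
  by (cases v) (auto simp: mvec_def mmul_def Gpbar_def msub_def Qmat_def QinfM_def madd_def mscale_def mId_def ikJplus_def
    Jmat_def heaviside_def jost_operator_def propagate_def phase_quotient_def zero_prod_def field_simps)


lemma solves_inteq_reflect:
  assumes "\<And>p x. p \<in> S \<Longrightarrow> integrable lborel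
      (\<lambda>t. mvec (mmul (G (snd p) (- x + t) (fst p)) (V (- t))) (F t p))"
    and "\<And>p x. p \<in> S \<Longrightarrow> F x p = F0 p +
      (\<integral>t. mvec (mmul (G (snd p) (- x + t) (fst p)) (V (- t))) (F t p) \<partial>lborel)"
  shows "solves_inteq G V F0 S (\<lambda>x. F (- x))"
  unfolding solves_inteq_def
proof (intro ballI allI conjI)
  fix p x assume p: "p \<in> S"
  let ?g = "\<lambda>t. mvec (mmul (G (snd p) (x - t) (fst p)) (V t)) (F (- t) p)"
  \<comment> \<open>The argument is spelled as an affine map so that the substitution rules for
    Lebesgue measure, with factor -1 and offset 0, match.\<close>
  have g: "?g (0 + - 1 * t) = mvec (mmul (G (snd p) (- (- x) + t) (fst p)) (V (- t))) (F t p)" for t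
    by simp
  show "integrable lborel ?g"
    using assms(1)[OF p, of "- x"] lborel_integrable_real_affine_iff[of "- 1" ?g 0] unfolding g by simp
  show "F (- x) p = F0 p + integral\<^sup>L lborel ?g"
    using assms(2)[OF p, of "- x"] lborel_integral_real_affine[of "- 1" ?g 0] unfolding g by simp
qed

lemma regular_on_reflect: "regular_on q0 lam S F \<Longrightarrow> regular_on q0 lam S (\<lambda>x. F (- x))"
  by (simp add: regular_on_def)

text \<open>Reflection interchanges the two potential entries up to sign, so the same two
  integrability conditions at -\<infinity> serve M, Mbar and the reflected N, Nbar.\<close>

lemma eigenfunctions_exist:
  assumes q0: "q0 > 0" and S1: "admissible 1 q0 S1 \<rho>" and S2: "admissible (- 1) q0 S2 \<rho>"
    and meas [measurable]: "q \<in> borel_measurable borel"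
    and int_m: "\<And>x. set_integrable lborel {..x} (\<lambda>t. \<rho> t * norm (q t - qm))"
    and int_p: "\<And>x. set_integrable lborel {..x} (\<lambda>t. \<rho> t * norm (q (- t) - qp))"
  shows "\<exists>M. M_eq q qp qm S1 M \<and> regular_on q0 (lambda1 q0) S1 M"
    and "\<exists>N. N_eq q qp qm S1 N \<and> regular_on q0 (lambda1 q0) S1 N"
    and "\<exists>Mb. Mbar_eq q qp qm S2 Mb \<and> regular_on q0 (\<lambda>k. - lambda1 q0 k) S2 Mb"
    and "\<exists>Nb. Nbar_eq q qp qm S2 Nb \<and> regular_on q0 (\<lambda>k. - lambda1 q0 k) S2 Nb"
proof -
  have meas': "(\<lambda>t. q t - qm) \<in> borel_measurable borel" "(\<lambda>t. q (- t) - qp) \<in> borel_measurable borel"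
    "(\<lambda>t. qm - q t) \<in> borel_measurable borel" "(\<lambda>t. qp - q (- t)) \<in> borel_measurable borel"
    by measurable
  have int1: "set_integrable lborel {..x} (\<lambda>t. \<rho> t * (norm (q t - qm) + norm (q (- t) - qp)))" for x
    using set_integral_add(1)[OF int_m[of x] int_p[of x]] by (simp add: distrib_left)
  have int2: "set_integrable lborel {..x} (\<lambda>t. \<rho> t * (norm (qp - q (- t)) + norm (qm - q t)))" for x
    using int1[of x] by (simp add: norm_minus_commute add.commute)
  have cont: "continuous_on UNIV (\<lambda>p::complex \<times> complex. (snd p + fst p, c))"
    "continuous_on UNIV (\<lambda>p::complex \<times> complex. (c, snd p + fst p))"
    for c :: complex
    by (auto intro!: continuous_intros)
  have "(\<lambda>k. \<sigma> * lambda1 q0 k + k) holomorphic_on sheet_domain q0" for \<sigma>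
    by (intro holomorphic_intros holomorphic_lambda1)
  then have hol: "(\<lambda>k. fst ((\<lambda>p. (snd p + fst p, c)) (k, \<sigma> * lambda1 q0 k))) holomorphic_on sheet_domain q0"
    "(\<lambda>k. snd ((\<lambda>p. (snd p + fst p, c)) (k, \<sigma> * lambda1 q0 k))) holomorphic_on sheet_domain q0"
    "(\<lambda>k. fst ((\<lambda>p. (c, snd p + fst p)) (k, \<sigma> * lambda1 q0 k))) holomorphic_on sheet_domain q0"
    "(\<lambda>k. snd ((\<lambda>p. (c, snd p + fst p)) (k, \<sigma> * lambda1 q0 k))) holomorphic_on sheet_domain q0"
    for \<sigma> c :: complex
    by simp_all
  have sq: "1 * 1 = (1 :: complex)" "- 1 * - 1 = (1 :: complex)"
    by simp_all
  obtain M where M: "\<And>p x. p \<in> S1 \<Longrightarrow> integrable lborel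
      (\<lambda>t. jost_operator 1 \<i> qm qp (\<lambda>t. q t - qm) (\<lambda>t. q (- t) - qp) p x t (M t p))"
    "\<And>p x. p \<in> S1 \<Longrightarrow> M x p = (snd p + fst p, \<i> * qp) +
      (\<integral>t. jost_operator 1 \<i> qm qp (\<lambda>t. q t - qm) (\<lambda>t. q (- t) - qp) p x t (M t p) \<partial>lborel)"
    "regular_on q0 (\<lambda>k. 1 * lambda1 q0 k) S1 M"
    by (rule jost_operator_solution[OF q0 sq(1) S1 meas'(1,2) int1 cont(1) hol(1,2)]) (rule that)
  from M(1,2) have "M_eq q qp qm S1 M"
    unfolding M_eq_def solves_inteq_def Gm_eq_jost_operator by blast
  moreover have "regular_on q0 (lambda1 q0) S1 M"
    using M(3) by simp
  ultimately show "\<exists>M. M_eq q qp qm S1 M \<and> regular_on q0 (lambda1 q0) S1 M"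
    by blast
  obtain N where N: "\<And>p x. p \<in> S1 \<Longrightarrow> integrable lborel
      (\<lambda>t. jost_operator 1 (- \<i>) (- qp) (- qm) (\<lambda>t. qp - q (- t)) (\<lambda>t. qm - q t) p x t (N t p))"
    "\<And>p x. p \<in> S1 \<Longrightarrow> N x p = (- \<i> * qp, snd p + fst p) +
      (\<integral>t. jost_operator 1 (- \<i>) (- qp) (- qm) (\<lambda>t. qp - q (- t)) (\<lambda>t. qm - q t) p x t (N t p) \<partial>lborel)"
    "regular_on q0 (\<lambda>k. 1 * lambda1 q0 k) S1 N"
    by (rule jost_operator_solution[OF q0 sq(1) S1 meas'(4,3) int2 cont(2) hol(3,4)]) (rule that)
  from N(1,2) have "N_eq q qp qm S1 (\<lambda>x. N (- x))"
    unfolding Gp_eq_jost_operator[symmetric] N_eq_def by (rule solves_inteq_reflect)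
  moreover have "regular_on q0 (lambda1 q0) S1 (\<lambda>x. N (- x))"
    using regular_on_reflect[OF N(3)] by simp
  ultimately show "\<exists>N. N_eq q qp qm S1 N \<and> regular_on q0 (lambda1 q0) S1 N"
    by blast
  obtain Mb where Mb: "\<And>p x. p \<in> S2 \<Longrightarrow> integrable lborel
      (\<lambda>t. jost_operator (- 1) \<i> qm qp (\<lambda>t. q t - qm) (\<lambda>t. q (- t) - qp) p x t (Mb t p))"
    "\<And>p x. p \<in> S2 \<Longrightarrow> Mb x p = (- \<i> * qm, snd p + fst p) +
      (\<integral>t. jost_operator (- 1) \<i> qm qp (\<lambda>t. q t - qm) (\<lambda>t. q (- t) - qp) p x t (Mb t p) \<partial>lborel)"
    "regular_on q0 (\<lambda>k. (- 1) * lambda1 q0 k) S2 Mb"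
    by (rule jost_operator_solution[OF q0 sq(2) S2 meas'(1,2) int1 cont(2) hol(3,4)]) (rule that)
  from Mb(1,2) have "Mbar_eq q qp qm S2 Mb"
    unfolding Mbar_eq_def solves_inteq_def Gmbar_eq_jost_operator by blast
  moreover have "regular_on q0 (\<lambda>k. - lambda1 q0 k) S2 Mb"
    using Mb(3) by simp
  ultimately show "\<exists>Mb. Mbar_eq q qp qm S2 Mb \<and> regular_on q0 (\<lambda>k. - lambda1 q0 k) S2 Mb"
    by blast
  obtain Nb where Nb: "\<And>p x. p \<in> S2 \<Longrightarrow> integrable lborel
      (\<lambda>t. jost_operator (- 1) (- \<i>) (- qp) (- qm) (\<lambda>t. qp - q (- t)) (\<lambda>t. qm - q t) p x t (Nb t p))"
    "\<And>p x. p \<in> S2 \<Longrightarrow> Nb x p = (snd p + fst p, \<i> * qm) +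
      (\<integral>t. jost_operator (- 1) (- \<i>) (- qp) (- qm) (\<lambda>t. qp - q (- t)) (\<lambda>t. qm - q t) p x t (Nb t p) \<partial>lborel)"
    "regular_on q0 (\<lambda>k. (- 1) * lambda1 q0 k) S2 Nb"
    by (rule jost_operator_solution[OF q0 sq(2) S2 meas'(4,3) int2 cont(1) hol(1,2)]) (rule that)
  from Nb(1,2) have "Nbar_eq q qp qm S2 (\<lambda>x. Nb (- x))"
    unfolding Gpbar_eq_jost_operator[symmetric] Nbar_eq_def by (rule solves_inteq_reflect)
  moreover have "regular_on q0 (\<lambda>k. - lambda1 q0 k) S2 (\<lambda>x. Nb (- x))"
    using regular_on_reflect[OF Nb(3)] by simp
  ultimately show "\<exists>Nb. Nbar_eq q qp qm S2 Nb \<and> regular_on q0 (\<lambda>k. - lambda1 q0 k) S2 Nb"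
    by blast
qed

text \<open>Passes from the quadratic moment to the linear weight that the kernel bound consumes, as
  1 + |t| \<ge> 1.\<close>

lemma set_integrable_moment:
  fixes f :: "real \<Rightarrow> real"
  assumes "f \<in> borel_measurable borel" "A \<in> sets borel" "\<And>t. 0 \<le> f t"
    and "set_integrable lborel A (\<lambda>t. (1 + \<bar>t\<bar>)\<^sup>2 * f t)"
  shows "set_integrable lborel A (\<lambda>t. (1 + \<bar>t\<bar>) * f t)"
  unfolding set_integrable_def
proof (rule Bochner_Integration.integrable_bound[OF assms(4)[unfolded set_integrable_def]])
  note [measurable] = assms(1,2)
  show "(\<lambda>t. indicator A t *\<^sub>R ((1 + \<bar>t\<bar>) * f t)) \<in> borel_measurable lborel"
    by measurable
  have "(1 + \<bar>t\<bar>) * f t \<le> (1 + \<bar>t\<bar>)\<^sup>2 * f t" for t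
    using assms(3)[of t] by (intro mult_right_mono) (auto simp: power2_eq_square algebra_simps)
  then show "AE t in lborel. norm (indicator A t *\<^sub>R ((1 + \<bar>t\<bar>) * f t))
      \<le> norm (indicator A t *\<^sub>R ((1 + \<bar>t\<bar>)\<^sup>2 * f t))"
    using assms(3) by (intro AE_I2) (auto simp: indicator_def abs_mult)
qed

theorem theorem1:
  fixes q :: "real \<Rightarrow> complex" and q0 \<theta>p \<theta>m :: real and qp qm :: complex
  assumes q0_pos: "q0 > 0"
    and theta_p: "\<theta>p \<in> {0..<2 * pi}" and theta_m: "\<theta>m \<in> {0..<2 * pi}"
    and theta_sum: "\<exists>n::int. \<theta>p + \<theta>m = 2 * pi * of_int n"
    and qp_def: "qp = of_real q0 * exp (\<i> * of_real \<theta>p)"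
    and qm_def: "qm = of_real q0 * exp (\<i> * of_real \<theta>m)"
    and lim_p: "(q \<longlongrightarrow> qp) at_top" and lim_m: "(q \<longlongrightarrow> qm) at_bot"
    and L1_p: "set_integrable lborel {0..} (\<lambda>x. q x - qp)"
    and L1_m: "set_integrable lborel {..0} (\<lambda>x. q x - qm)"
  shows
    "((\<exists>M. M_eq q qp qm (closed_sheet1 q0 - branch_points q0) M \<and>
           regular_on q0 (lambda1 q0) (closed_sheet1 q0 - branch_points q0) M) \<and>
      (\<exists>N. N_eq q qp qm (closed_sheet1 q0 - branch_points q0) N \<and>
           regular_on q0 (lambda1 q0) (closed_sheet1 q0 - branch_points q0) N) \<and>
      (\<exists>Mb. Mbar_eq q qp qm (closed_sheet2 q0 - branch_points q0) Mb \<and>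
           regular_on q0 (\<lambda>k. - lambda1 q0 k) (closed_sheet2 q0 - branch_points q0) Mb) \<and>
      (\<exists>Nb. Nbar_eq q qp qm (closed_sheet2 q0 - branch_points q0) Nb \<and>
           regular_on q0 (\<lambda>k. - lambda1 q0 k) (closed_sheet2 q0 - branch_points q0) Nb))
     \<and>
     ((set_integrable lborel {0..} (\<lambda>x. (1 + \<bar>x\<bar>)\<^sup>2 * cmod (q x - qp)) \<and>
       set_integrable lborel {..0} (\<lambda>x. (1 + \<bar>x\<bar>)\<^sup>2 * cmod (q x - qm))) \<longrightarrow>
      (\<exists>M. M_eq q qp qm (closed_sheet1 q0) M \<and> regular_on q0 (lambda1 q0) (closed_sheet1 q0) M) \<and>
      (\<exists>N. N_eq q qp qm (closed_sheet1 q0) N \<and> regular_on q0 (lambda1 q0) (closed_sheet1 q0) N) \<and>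
      (\<exists>Mb. Mbar_eq q qp qm (closed_sheet2 q0) Mb \<and>
           regular_on q0 (\<lambda>k. - lambda1 q0 k) (closed_sheet2 q0) Mb) \<and>
      (\<exists>Nb. Nbar_eq q qp qm (closed_sheet2 q0) Nb \<and>
           regular_on q0 (\<lambda>k. - lambda1 q0 k) (closed_sheet2 q0) Nb))"
proof -
  \<comment> \<open>Borel measurability of \<open>q\<close> is recovered from integrability on the
    two half lines, by gluing the cut-off differences at 0.\<close>
  have "(\<lambda>t. indicator {0..} t *\<^sub>R (q t - qp)) \<in> borel_measurable borel"
    "(\<lambda>t. indicator {..0} t *\<^sub>R (q t - qm)) \<in> borel_measurable borel"
    using L1_p L1_m unfolding set_integrable_def by (auto dest: borel_measurable_integrable)
  then have "(\<lambda>t. if 0 \<le> t then indicator {0..} t *\<^sub>R (q t - qp) + qp else indicator {..0} t *\<^sub>R (q t - qm) + qm)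
      \<in> borel_measurable borel"
    by measurable
  also have "(\<lambda>t. if 0 \<le> t then indicator {0..} t *\<^sub>R (q t - qp) + qp else indicator {..0} t *\<^sub>R (q t - qm) + qm) = q"
    by (auto simp: fun_eq_iff)
  finally have meas [measurable]: "q \<in> borel_measurable borel" .
  have reflect: "set_integrable lborel {..0} (\<lambda>t. f (- t)) \<longleftrightarrow> set_integrable lborel {0..} f"
    "set_integrable lborel {0..} (\<lambda>t. f (- t)) \<longleftrightarrow> set_integrable lborel {..0} f"
    for f :: "real \<Rightarrow> 'a::{banach, second_countable_topology}"
    using set_integrable_reflect[of "{0..}" f] set_integrable_reflect[of "{..0}" f] by simp_all
  have sheets: "closed_sheet1 q0 = sheet 1 q0" "closed_sheet2 q0 = sheet (- 1) q0"
    by (simp_all add: closed_sheet1_def closed_sheet2_def sheet_def)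
  \<comment> \<open>For t \<le> 0 the difference q(-t) - q_+ is a reflected copy of q - q_+ on the
    right half line, which is where evenness of \<open>\<rho>\<close> enters; for t > 0 it is
    compared with q_- instead, through \<open>L1_m\<close>.\<close>
  have weighted: "set_integrable lborel {..x} (\<lambda>t. \<rho> t * norm (q t - qm))"
    "set_integrable lborel {..x} (\<lambda>t. \<rho> t * norm (q (- t) - qp))"
    if \<rho>: "continuous_on UNIV \<rho>" "\<And>t. \<rho> (- t) = \<rho> t"
      and p: "set_integrable lborel {0..} (\<lambda>t. \<rho> t * norm (q t - qp))"
      and m: "set_integrable lborel {..0} (\<lambda>t. \<rho> t * norm (q t - qm))" for \<rho> x
  proof -
    show "set_integrable lborel {..x} (\<lambda>t. \<rho> t * norm (q t - qm))"
      by (rule set_integrable_weighted_difference[OF meas \<rho>(1) m L1_p])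
    have left: "set_integrable lborel {..0} (\<lambda>t. \<rho> t * norm (q (- t) - qp))"
      using p reflect(1)[of "\<lambda>t. \<rho> t * norm (q t - qp)"] by (simp add: \<rho>(2))
    have right: "set_integrable lborel {0..} (\<lambda>t. q (- t) - qm)"
      using L1_m reflect(2)[of "\<lambda>t. q t - qm"] by simp
    have "(\<lambda>t. q (- t)) \<in> borel_measurable borel" by measurable
    then show "set_integrable lborel {..x} (\<lambda>t. \<rho> t * norm (q (- t) - qp))"
      by (rule set_integrable_weighted_difference[OF _ \<rho>(1) left right])
  qed
  have adm: "admissible 1 q0 (closed_sheet1 q0 - branch_points q0) (\<lambda>_. 1)"
    "admissible (- 1) q0 (closed_sheet2 q0 - branch_points q0) (\<lambda>_. 1)"
    "admissible 1 q0 (closed_sheet1 q0) (\<lambda>t. 1 + \<bar>t\<bar>)"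
    "admissible (- 1) q0 (closed_sheet2 q0) (\<lambda>t. 1 + \<bar>t\<bar>)"
    by (simp_all add: admissible_def sheets)
  have "set_integrable lborel {0..} (\<lambda>t. 1 * norm (q t - qp))"
    "set_integrable lborel {..0} (\<lambda>t. 1 * norm (q t - qm))"
    using set_integrable_norm[OF L1_p] set_integrable_norm[OF L1_m] by simp_all
  note w1 = weighted[OF continuous_on_const refl this]
  note away_from_branch_points = eigenfunctions_exist[OF q0_pos adm(1,2) meas w1]
  show ?thesis
  proof (intro conjI impI away_from_branch_points; elim conjE)
    assume p: "set_integrable lborel {0..} (\<lambda>t. (1 + \<bar>t\<bar>)\<^sup>2 * norm (q t - qp))"
      and m: "set_integrable lborel {..0} (\<lambda>t. (1 + \<bar>t\<bar>)\<^sup>2 * norm (q t - qm))"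
    have "continuous_on UNIV (\<lambda>t::real. 1 + \<bar>t\<bar>)"
      by (intro continuous_intros)
    moreover have "set_integrable lborel {0..} (\<lambda>t. (1 + \<bar>t\<bar>) * norm (q t - qp))"
      by (rule set_integrable_moment[OF _ _ _ p]) auto
    moreover have "set_integrable lborel {..0} (\<lambda>t. (1 + \<bar>t\<bar>) * norm (q t - qm))"
      by (rule set_integrable_moment[OF _ _ _ m]) auto
    ultimately have w2: "set_integrable lborel {..x} (\<lambda>t. (1 + \<bar>t\<bar>) * norm (q t - qm))"
      "set_integrable lborel {..x} (\<lambda>t. (1 + \<bar>t\<bar>) * norm (q (- t) - qp))" for x
      using weighted[of "\<lambda>t. 1 + \<bar>t\<bar>" x] by simp_all
    note on_sheet = eigenfunctions_exist[OF q0_pos adm(3,4) meas w2]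
    show "\<exists>M. M_eq q qp qm (closed_sheet1 q0) M \<and> regular_on q0 (lambda1 q0) (closed_sheet1 q0) M"
      "\<exists>N. N_eq q qp qm (closed_sheet1 q0) N \<and> regular_on q0 (lambda1 q0) (closed_sheet1 q0) N"
      "\<exists>Mb. Mbar_eq q qp qm (closed_sheet2 q0) Mb \<and> regular_on q0 (\<lambda>k. - lambda1 q0 k) (closed_sheet2 q0) Mb"
      "\<exists>Nb. Nbar_eq q qp qm (closed_sheet2 q0) Nb \<and> regular_on q0 (\<lambda>k. - lambda1 q0 k) (closed_sheet2 q0) Nb"
      by (fact on_sheet)+
  qed
qed

end
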